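(* Suppose $\psi(M_1)\neq 0$. Let $S$ be an irreducible Whittaker module of type $\psi$ for the Schrödinger-Virasoro algebra $\mathfrak{sv}$. Then $S\cong L_{\psi,\xi}$ for some $\xi\in\mathbb{C}$.
   Context: The Schrödinger-Virasoro algebra $\mathfrak{sv}$ is the complex Lie algebra with basis $\{L_n,M_n,Y_{n+\frac12}\mid n\in\mathbb{Z}\}$ and brackets, for $m,n\in\mathbb{Z}$: $[L_m,L_n]=(n-m)L_{m+n}$, $[L_m,M_n]=nM_{m+n}$, $[L_m,Y_{n+\frac12}]=(n+\frac{1-m}{2})Y_{m+n+\frac12}$, $[Y_{m+\frac12},Y_{n+\frac12}]=(n-m)M_{m+n+1}$, $[M_m,M_n]=[M_m,Y_{n+\frac12}]=0$. The element $M_0$ is central. Put $\mathfrak{sv}^+=\mathrm{span}_{\mathbb{C}}\{L_n,M_n,Y_{m+\frac12}\mid n\geq 1,\ m\geq 0\}$. Let $\psi:\mathfrak{sv}^+\to\mathbb{C}$ be a Lie algebra homomorphism. A vector $v$ in an $\mathfrak{sv}$-module is a Whittaker vector (of type $\psi$) if $xv=\psi(x)v$ for all $x\in\mathfrak{sv}^+$; an $\mathfrak{sv}$-module is a Whittaker module of type $\psi$ if it is generated by a Whittaker vector of type $\psi$. Write $U(\cdot)$ for the universal enveloping algebra. Let $\mathbb{C}_\psi$ be the one-dimensional $\mathfrak{sv}^+$-module with $x\alpha=\psi(x)\alpha$ for $x\in\mathfrak{sv}^+$, $\alpha\in\mathbb{C}$, let $W_\psi=U(\mathfrak{sv})\otimes_{U(\mathfrak{sv}^+)}\mathbb{C}_\psi$,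 and for $\xi\in\mathbb{C}$ let $L_{\psi,\xi}=W_\psi/(M_0-\xi)W_\psi$. *)

theory Defs
  imports Complex_Main "HOL-Library.Poly_Mapping" "HOL-Algebra.Module" "HOL-Algebra.QuotRing"
    "HOL-Algebra.Algebraic_Closure_Type"
begin

section \<open>Complex vector spaces of finitely supported functions\<close>

abbreviation complex_ring :: "complex ring" where
  "complex_ring \<equiv> ring_of_type_algebra"

definition fscale :: "complex \<Rightarrow> ('b \<Rightarrow>\<^sub>0 complex) \<Rightarrow> ('b \<Rightarrow>\<^sub>0 complex)" where
  "fscale c p = Poly_Mapping.map ((*) c) p"

definition basis_vec :: "'b \<Rightarrow> ('b \<Rightarrow>\<^sub>0 complex)" where
  "basis_vec b = Poly_Mapping.single b 1"

definition lin_ext :: "('b \<Rightarrow> ('c \<Rightarrow>\<^sub>0 complex)) \<Rightarrow> ('b \<Rightarrow>\<^sub>0 complex) \<Rightarrow> ('c \<Rightarrow>\<^sub>0 complex)" where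
  "lin_ext f p = (\<Sum>b\<in>Poly_Mapping.keys p. fscale (Poly_Mapping.lookup p b) (f b))"

abbreviation fspan :: "('b \<Rightarrow>\<^sub>0 complex) set \<Rightarrow> ('b \<Rightarrow>\<^sub>0 complex) set" where
  "fspan \<equiv> Modules.module.span fscale"

lemma lookup_fscale [simp]:
  "Poly_Mapping.lookup (fscale c p) b = c * Poly_Mapping.lookup p b"
  unfolding fscale_def by (simp add: Poly_Mapping.map.rep_eq when_def)

interpretation fvs: vector_space "fscale :: complex \<Rightarrow> ('b \<Rightarrow>\<^sub>0 complex) \<Rightarrow> _"
  by unfold_locales (auto intro!: poly_mapping_eqI simp: lookup_add algebra_simps)

lemma lin_ext_superset:
  assumes "finite A" "Poly_Mapping.keys p \<subseteq> A"
  shows "lin_ext f p = (\<Sum>b\<in>A. fscale (Poly_Mapping.lookup p b) (f b))"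
  unfolding lin_ext_def
  by (rule sum.mono_neutral_left) (use assms in \<open>auto simp: in_keys_iff\<close>)

lemma lin_ext_add: "lin_ext f (p + q) = lin_ext f p + lin_ext f q"
proof -
  let ?A = "Poly_Mapping.keys p \<union> Poly_Mapping.keys q"
  have "lin_ext f (p + q) = (\<Sum>b\<in>?A. fscale (Poly_Mapping.lookup (p + q) b) (f b))"
    by (rule lin_ext_superset) (auto dest: subsetD[OF Poly_Mapping.keys_add])
  also have "\<dots> = lin_ext f p + lin_ext f q"
    by (simp add: lin_ext_superset[of ?A p] lin_ext_superset[of ?A q] lookup_add
        fvs.scale_left_distrib sum.distrib)
  finally show ?thesis .
qed

lemma lin_ext_scale: "lin_ext f (fscale c p) = fscale c (lin_ext f p)"
proof -
  have "lin_ext f (fscale c p)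
      = (\<Sum>b\<in>Poly_Mapping.keys p. fscale (Poly_Mapping.lookup (fscale c p) b) (f b))"
    by (rule lin_ext_superset) (auto simp: in_keys_iff)
  then show ?thesis
    by (simp add: lin_ext_def fvs.scale_sum_right)
qed

lemma lin_ext_basis [simp]: "lin_ext f (basis_vec b) = f b"
  by (simp add: lin_ext_def basis_vec_def)

lemma lin_ext_zero [simp]: "lin_ext f 0 = 0"
  by (simp add: lin_ext_def)

lemma lin_ext_uminus: "lin_ext f (- p) = - lin_ext f p"
  using lin_ext_scale[of f "-1" p] by simp

lemma lin_ext_add_fun: "lin_ext (\<lambda>b. f b + g b) p = lin_ext f p + lin_ext g p"
  by (simp add: lin_ext_def fvs.scale_right_distrib sum.distrib)

lemma lin_ext_scale_fun: "lin_ext (\<lambda>b. fscale c (f b)) p = fscale c (lin_ext f p)"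
  by (simp add: lin_ext_def fvs.scale_sum_right mult.commute)

lemma fvs_induct [case_names zero basis add scale]:
  assumes "P 0" "\<And>b. P (basis_vec b)" "\<And>p q. P p \<Longrightarrow> P q \<Longrightarrow> P (p + q)"
    "\<And>c p. P p \<Longrightarrow> P (fscale c p)"
  shows "P p"
proof -
  have eq: "lin_ext basis_vec p = p" for p :: "'b \<Rightarrow>\<^sub>0 complex"
  proof (rule poly_mapping_eqI)
    fix k
    have "Poly_Mapping.lookup (lin_ext basis_vec p) k
        = (\<Sum>b\<in>Poly_Mapping.keys p. Poly_Mapping.lookup p b * (1 when b = k))"
      by (simp add: lin_ext_def lookup_sum basis_vec_def lookup_single)
    also have "\<dots> = (\<Sum>b\<in>Poly_Mapping.keys p. if b = k then Poly_Mapping.lookup p k else 0)"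
      by (rule sum.cong) (auto simp: when_def)
    also have "\<dots> = Poly_Mapping.lookup p k"
      by (simp add: in_keys_iff)
    finally show "Poly_Mapping.lookup (lin_ext basis_vec p) k = Poly_Mapping.lookup p k" .
  qed
  have "P (\<Sum>b\<in>A. fscale (f b) (basis_vec b))" if "finite A" for A f
    using that by (induction A) (auto intro: assms)
  then have "P (lin_ext basis_vec p)"
    unfolding lin_ext_def by simp
  then show ?thesis
    by (simp add: eq)
qed


section \<open>Lie algebras and their modules\<close>

text \<open>The fields \<^const>\<open>monoid.mult\<close> and \<^const>\<open>monoid.one\<close>, inherited from the library's
  record of modules, play no role in the structures below.\<close>

record 'g lie_alg = "(complex, 'g) module" +
  bracket :: "'g \<Rightarrow> 'g \<Rightarrow> 'g"

locale lie_algebra = module complex_ring G for G :: "'g lie_alg" (structure) +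
  assumes bracket_closed:
      "\<lbrakk>x \<in> carrier G; y \<in> carrier G\<rbrakk> \<Longrightarrow> bracket G x y \<in> carrier G"
    and bracket_add_left:
      "\<lbrakk>x \<in> carrier G; y \<in> carrier G; z \<in> carrier G\<rbrakk>
        \<Longrightarrow> bracket G (x \<oplus> y) z = bracket G x z \<oplus> bracket G y z"
    and bracket_add_right:
      "\<lbrakk>x \<in> carrier G; y \<in> carrier G; z \<in> carrier G\<rbrakk>
        \<Longrightarrow> bracket G x (y \<oplus> z) = bracket G x y \<oplus> bracket G x z"
    and bracket_smult_left:
      "\<lbrakk>x \<in> carrier G; y \<in> carrier G\<rbrakk> \<Longrightarrow> bracket G (c \<odot> x) y = c \<odot> bracket G x y"
    and bracket_smult_right:
      "\<lbrakk>x \<in> carrier G; y \<in> carrier G\<rbrakk> \<Longrightarrow> bracket G x (c \<odot> y) = c \<odot> bracket G x y"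
    and bracket_self: "x \<in> carrier G \<Longrightarrow> bracket G x x = \<zero>"
    and jacobi:
      "\<lbrakk>x \<in> carrier G; y \<in> carrier G; z \<in> carrier G\<rbrakk>
        \<Longrightarrow> bracket G x (bracket G y z) \<oplus> bracket G y (bracket G z x)
              \<oplus> bracket G z (bracket G x y) = \<zero>"

definition lie_hom :: "'g lie_alg \<Rightarrow> 'h lie_alg \<Rightarrow> ('g \<Rightarrow> 'h) \<Rightarrow> bool" where
  "lie_hom G H f \<longleftrightarrow>
     f \<in> carrier G \<rightarrow> carrier H
     \<and> (\<forall>x\<in>carrier G. \<forall>y\<in>carrier G. f (x \<oplus>\<^bsub>G\<^esub> y) = f x \<oplus>\<^bsub>H\<^esub> f y)
     \<and> (\<forall>c. \<forall>x\<in>carrier G. f (c \<odot>\<^bsub>G\<^esub> x) = c \<odot>\<^bsub>H\<^esub> f x)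
     \<and> (\<forall>x\<in>carrier G. \<forall>y\<in>carrier G. f (bracket G x y) = bracket H (f x) (f y))"

definition complex_lie :: "complex lie_alg" where
  "complex_lie = \<lparr>carrier = UNIV, monoid.mult = (*), monoid.one = 1, ring.zero = 0,
     ring.add = (+), module.smult = (*),
     bracket = (\<lambda>_ _. 0)\<rparr>"

record ('g, 'v) lie_mod = "(complex, 'v) module" +
  act :: "'g \<Rightarrow> 'v \<Rightarrow> 'v"

locale lie_module = G: lie_algebra G + V: module complex_ring V
  for G :: "'g lie_alg" and V :: "('g, 'v) lie_mod" +
  assumes act_closed: "\<lbrakk>x \<in> carrier G; v \<in> carrier V\<rbrakk> \<Longrightarrow> act V x v \<in> carrier V"
    and act_add_left:
      "\<lbrakk>x \<in> carrier G; y \<in> carrier G; v \<in> carrier V\<rbrakk>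
        \<Longrightarrow> act V (x \<oplus>\<^bsub>G\<^esub> y) v = act V x v \<oplus>\<^bsub>V\<^esub> act V y v"
    and act_smult_left:
      "\<lbrakk>x \<in> carrier G; v \<in> carrier V\<rbrakk> \<Longrightarrow> act V (c \<odot>\<^bsub>G\<^esub> x) v = c \<odot>\<^bsub>V\<^esub> act V x v"
    and act_add_right:
      "\<lbrakk>x \<in> carrier G; v \<in> carrier V; w \<in> carrier V\<rbrakk>
        \<Longrightarrow> act V x (v \<oplus>\<^bsub>V\<^esub> w) = act V x v \<oplus>\<^bsub>V\<^esub> act V x w"
    and act_smult_right:
      "\<lbrakk>x \<in> carrier G; v \<in> carrier V\<rbrakk> \<Longrightarrow> act V x (c \<odot>\<^bsub>V\<^esub> v) = c \<odot>\<^bsub>V\<^esub> act V x v"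
    and act_bracket:
      "\<lbrakk>x \<in> carrier G; y \<in> carrier G; v \<in> carrier V\<rbrakk>
        \<Longrightarrow> act V (bracket G x y) v = act V x (act V y v) \<ominus>\<^bsub>V\<^esub> act V y (act V x v)"

definition lie_submodule :: "'g lie_alg \<Rightarrow> ('g, 'v) lie_mod \<Rightarrow> 'v set \<Rightarrow> bool" where
  "lie_submodule G V N \<longleftrightarrow>
     submodule N complex_ring V \<and> (\<forall>x\<in>carrier G. \<forall>v\<in>N. act V x v \<in> N)"

definition lie_generated :: "'g lie_alg \<Rightarrow> ('g, 'v) lie_mod \<Rightarrow> 'v set \<Rightarrow> 'v set" where
  "lie_generated G V A = \<Inter>{N. lie_submodule G V N \<and> A \<subseteq> N}"

definition irreducible_lie_module :: "'g lie_alg \<Rightarrow> ('g, 'v) lie_mod \<Rightarrow> bool" where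
  "irreducible_lie_module G V \<longleftrightarrow>
     lie_module G V \<and> carrier V \<noteq> {\<zero>\<^bsub>V\<^esub>}
     \<and> (\<forall>N. lie_submodule G V N \<longrightarrow> N = {\<zero>\<^bsub>V\<^esub>} \<or> N = carrier V)"

definition lie_module_iso ::
    "'g lie_alg \<Rightarrow> ('g, 'v) lie_mod \<Rightarrow> ('g, 'w) lie_mod \<Rightarrow> ('v \<Rightarrow> 'w) \<Rightarrow> bool" where
  "lie_module_iso G V W f \<longleftrightarrow>
     bij_betw f (carrier V) (carrier W)
     \<and> (\<forall>v\<in>carrier V. \<forall>v'\<in>carrier V. f (v \<oplus>\<^bsub>V\<^esub> v') = f v \<oplus>\<^bsub>W\<^esub> f v')
     \<and> (\<forall>c. \<forall>v\<in>carrier V. f (c \<odot>\<^bsub>V\<^esub> v) = c \<odot>\<^bsub>W\<^esub> f v)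
     \<and> (\<forall>x\<in>carrier G. \<forall>v\<in>carrier V. f (act V x v) = act W x (f v))"

definition lie_modules_isomorphic ::
    "'g lie_alg \<Rightarrow> ('g, 'v) lie_mod \<Rightarrow> ('g, 'w) lie_mod \<Rightarrow> bool" where
  "lie_modules_isomorphic G V W \<longleftrightarrow> (\<exists>f. lie_module_iso G V W f)"

text \<open>The quotient \<open>V / N\<close>, with operations on cosets in the style of \<^const>\<open>FactRing\<close>.\<close>

definition quot_mod :: "('g, 'v) lie_mod \<Rightarrow> 'v set \<Rightarrow> ('g, 'v set) lie_mod" where
  "quot_mod V N = \<lparr>carrier = a_rcosets\<^bsub>V\<^esub> N, monoid.mult = undefined, monoid.one = undefined,
     ring.zero = N, ring.add = set_add V,
     module.smult = (\<lambda>c C. \<Union>v\<in>C. N +>\<^bsub>V\<^esub> (c \<odot>\<^bsub>V\<^esub> v)),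
     act = (\<lambda>x C. \<Union>v\<in>C. N +>\<^bsub>V\<^esub> act V x v)\<rparr>"


section \<open>Universal enveloping algebras\<close>

text \<open>The type of words is a copy of the type of lists, made a monoid under concatenation, so that
  \<open>'g word \<Rightarrow>\<^sub>0 complex\<close> with the library's convolution product is the free associative unital
  complex algebra on \<open>'g\<close>.\<close>

datatype 'g word = Word (letters: "'g list")

instantiation word :: (type) monoid_add
begin
definition zero_word_def: "0 = Word []"
definition plus_word_def: "v + w = Word (letters v @ letters w)"
instance by standard (auto simp: zero_word_def plus_word_def)
end

definition free_alg :: "'g set \<Rightarrow> ('g word \<Rightarrow>\<^sub>0 complex) ring" where
  "free_alg A = \<lparr>carrier = {p. \<forall>w\<in>Poly_Mapping.keys p. set (letters w) \<subseteq> A},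
     monoid.mult = (*), monoid.one = 1, ring.zero = 0, ring.add = (+)\<rparr>"

definition letter :: "'g \<Rightarrow> ('g word \<Rightarrow>\<^sub>0 complex)" where
  "letter x = basis_vec (Word [x])"

text \<open>The linearity relations turn the free algebra on the set of elements of \<open>\<gg>\<close> into the tensor
  algebra of the vector space \<open>\<gg>\<close>; the last family are the relations \<open>xy - yx = [x,y]\<close>.\<close>

definition uea_relations :: "'g lie_alg \<Rightarrow> ('g word \<Rightarrow>\<^sub>0 complex) set" where
  "uea_relations G =
     {letter (x \<oplus>\<^bsub>G\<^esub> y) - letter x - letter y | x y. x \<in> carrier G \<and> y \<in> carrier G}
   \<union> {letter (c \<odot>\<^bsub>G\<^esub> x) - fscale c (letter x) | c x. x \<in> carrier G}
   \<union> {letter x * letter y - letter y * letter x - letter (bracket G x y) | x y.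
        x \<in> carrier G \<and> y \<in> carrier G}"

definition uea_ideal :: "'g lie_alg \<Rightarrow> ('g word \<Rightarrow>\<^sub>0 complex) set" where
  "uea_ideal G = genideal (free_alg (carrier G)) (uea_relations G)"

definition uea :: "'g lie_alg \<Rightarrow> ('g word \<Rightarrow>\<^sub>0 complex) set ring" where
  "uea G = free_alg (carrier G) Quot uea_ideal G"

definition uea_class :: "'g lie_alg \<Rightarrow> ('g word \<Rightarrow>\<^sub>0 complex) \<Rightarrow> ('g word \<Rightarrow>\<^sub>0 complex) set" where
  "uea_class G p = uea_ideal G +>\<^bsub>free_alg (carrier G)\<^esub> p"

text \<open>For a Lie subalgebra \<open>H\<close> of \<open>G\<close>, the algebra homomorphism \<open>U(H) \<rightarrow> U(G)\<close> induced by the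
  inclusion. It maps the class of \<open>p\<close> to the class of \<open>p\<close>, independently of the representative.\<close>

definition uea_incl ::
    "'g lie_alg \<Rightarrow> 'g lie_alg \<Rightarrow> ('g word \<Rightarrow>\<^sub>0 complex) set \<Rightarrow> ('g word \<Rightarrow>\<^sub>0 complex) set" where
  "uea_incl H G C = the_elem (uea_class G ` C)"

definition free_act :: "('g, 'v) lie_mod \<Rightarrow> ('g word \<Rightarrow>\<^sub>0 complex) \<Rightarrow> 'v \<Rightarrow> 'v" where
  "free_act V p v =
     (\<Oplus>\<^bsub>V\<^esub>w\<in>Poly_Mapping.keys p. Poly_Mapping.lookup p w \<odot>\<^bsub>V\<^esub> foldr (act V) (letters w) v)"

text \<open>The \<open>U(\<gg>)\<close>-module structure of a \<open>\<gg>\<close>-module; again the choice of representative does not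
  matter.\<close>

definition uea_act :: "('g, 'v) lie_mod \<Rightarrow> ('g word \<Rightarrow>\<^sub>0 complex) set \<Rightarrow> 'v \<Rightarrow> 'v" where
  "uea_act V C v = the_elem ((\<lambda>p. free_act V p v) ` C)"


section \<open>Induced modules\<close>

text \<open>\<open>U(G) \<otimes>\<^bsub>U(H)\<^esub> V\<close> is the complex vector space with basis \<open>U(G) \<times> V\<close> modulo the span of the
  bilinearity and balancing relations; \<open>G\<close> acts by left multiplication on the first factor.
  The free space \<open>tensor_free\<close> itself is not yet a \<open>G\<close>-module, only its quotient is.\<close>

definition pure :: "'a \<Rightarrow> 'b \<Rightarrow> ('a \<times> 'b \<Rightarrow>\<^sub>0 complex)" where
  "pure u v = basis_vec (u, v)"

definition tensor_relations ::
    "'g lie_alg \<Rightarrow> 'g lie_alg \<Rightarrow> ('g, 'v) lie_mod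
      \<Rightarrow> (('g word \<Rightarrow>\<^sub>0 complex) set \<times> 'v \<Rightarrow>\<^sub>0 complex) set" where
  "tensor_relations G H V =
     {pure (u \<oplus>\<^bsub>uea G\<^esub> u') v - pure u v - pure u' v | u u' v.
        u \<in> carrier (uea G) \<and> u' \<in> carrier (uea G) \<and> v \<in> carrier V}
   \<union> {pure u (v \<oplus>\<^bsub>V\<^esub> v') - pure u v - pure u v' | u v v'.
        u \<in> carrier (uea G) \<and> v \<in> carrier V \<and> v' \<in> carrier V}
   \<union> {pure (uea_class G (fscale c 1) \<otimes>\<^bsub>uea G\<^esub> u) v - fscale c (pure u v) | c u v.
        u \<in> carrier (uea G) \<and> v \<in> carrier V}
   \<union> {pure u (c \<odot>\<^bsub>V\<^esub> v) - fscale c (pure u v) | c u v.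
        u \<in> carrier (uea G) \<and> v \<in> carrier V}
   \<union> {pure (u \<otimes>\<^bsub>uea G\<^esub> uea_incl H G r) v - pure u (uea_act V r v) | u r v.
        u \<in> carrier (uea G) \<and> r \<in> carrier (uea H) \<and> v \<in> carrier V}"

definition tensor_free ::
    "'g lie_alg \<Rightarrow> ('g, 'v) lie_mod
      \<Rightarrow> ('g, ('g word \<Rightarrow>\<^sub>0 complex) set \<times> 'v \<Rightarrow>\<^sub>0 complex) lie_mod" where
  "tensor_free G V =
     \<lparr>carrier = {t. Poly_Mapping.keys t \<subseteq> carrier (uea G) \<times> carrier V},
      monoid.mult = undefined, monoid.one = undefined, ring.zero = 0, ring.add = (+),
      module.smult = fscale,
      act = (\<lambda>x. lin_ext (\<lambda>(u, v). pure (uea_class G (letter x) \<otimes>\<^bsub>uea G\<^esub> u) v))\<rparr>"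

definition induced_module ::
    "'g lie_alg \<Rightarrow> 'g lie_alg \<Rightarrow> ('g, 'v) lie_mod
      \<Rightarrow> ('g, (('g word \<Rightarrow>\<^sub>0 complex) set \<times> 'v \<Rightarrow>\<^sub>0 complex) set) lie_mod" where
  "induced_module G H V = quot_mod (tensor_free G V) (fspan (tensor_relations G H V))"


section \<open>The Schroedinger-Virasoro algebra\<close>

text \<open>The index \<open>Y n\<close> stands for the basis vector with half-integer subscript \<open>n + 1/2\<close>.\<close>

datatype sv_index = L int | M int | Y int

type_synonym sv = "sv_index \<Rightarrow>\<^sub>0 complex"

fun sv_basis_bracket :: "sv_index \<Rightarrow> sv_index \<Rightarrow> sv" where
  "sv_basis_bracket (L m) (L n) = fscale (of_int n - of_int m) (basis_vec (L (m + n)))"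
| "sv_basis_bracket (L m) (M n) = fscale (of_int n) (basis_vec (M (m + n)))"
| "sv_basis_bracket (M n) (L m) = fscale (- of_int n) (basis_vec (M (m + n)))"
| "sv_basis_bracket (L m) (Y n) =
     fscale (of_int n + (1 - of_int m) / 2) (basis_vec (Y (m + n)))"
| "sv_basis_bracket (Y n) (L m) =
     fscale (- (of_int n + (1 - of_int m) / 2)) (basis_vec (Y (m + n)))"
| "sv_basis_bracket (Y m) (Y n) = fscale (of_int n - of_int m) (basis_vec (M (m + n + 1)))"
| "sv_basis_bracket (M m) (M n) = 0"
| "sv_basis_bracket (M m) (Y n) = 0"
| "sv_basis_bracket (Y n) (M m) = 0"

definition sv_bracket :: "sv \<Rightarrow> sv \<Rightarrow> sv" where
  "sv_bracket x y = lin_ext (\<lambda>a. lin_ext (sv_basis_bracket a) y) x"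

definition sv :: "sv lie_alg" where
  "sv = \<lparr>carrier = UNIV, monoid.mult = undefined, monoid.one = undefined, ring.zero = 0,
     ring.add = (+), module.smult = fscale, bracket = sv_bracket\<rparr>"

definition sv_plus :: "sv lie_alg" where
  "sv_plus = sv\<lparr>carrier := fspan
     ({basis_vec (L n) | n. n \<ge> 1} \<union> {basis_vec (M n) | n. n \<ge> 1} \<union> {basis_vec (Y m) | m. m \<ge> 0})\<rparr>"


section \<open>Whittaker modules\<close>

definition whittaker_vector :: "(sv \<Rightarrow> complex) \<Rightarrow> (sv, 'v) lie_mod \<Rightarrow> 'v \<Rightarrow> bool" where
  "whittaker_vector \<psi> V w \<longleftrightarrow>
     w \<in> carrier V \<and> (\<forall>x\<in>carrier sv_plus. act V x w = \<psi> x \<odot>\<^bsub>V\<^esub> w)"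

definition whittaker_module :: "(sv \<Rightarrow> complex) \<Rightarrow> (sv, 'v) lie_mod \<Rightarrow> bool" where
  "whittaker_module \<psi> V \<longleftrightarrow>
     lie_module sv V \<and> (\<exists>w. whittaker_vector \<psi> V w \<and> lie_generated sv V {w} = carrier V)"

definition one_dim_module :: "(sv \<Rightarrow> complex) \<Rightarrow> (sv, complex) lie_mod" where
  "one_dim_module \<psi> = \<lparr>carrier = UNIV, monoid.mult = (*), monoid.one = 1, ring.zero = 0,
     ring.add = (+), module.smult = (*),
     act = (\<lambda>x \<alpha>. \<psi> x * \<alpha>)\<rparr>"

type_synonym whittaker_carrier = "((sv word \<Rightarrow>\<^sub>0 complex) set \<times> complex \<Rightarrow>\<^sub>0 complex) set"

definition universal_whittaker :: "(sv \<Rightarrow> complex) \<Rightarrow> (sv, whittaker_carrier) lie_mod" where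
  "universal_whittaker \<psi> = induced_module sv sv_plus (one_dim_module \<psi>)"

definition whittaker_quotient ::
    "(sv \<Rightarrow> complex) \<Rightarrow> complex \<Rightarrow> (sv, whittaker_carrier set) lie_mod" where
  "whittaker_quotient \<psi> \<xi> =
     (let W = universal_whittaker \<psi>
      in quot_mod W {act W (basis_vec (M 0)) w \<ominus>\<^bsub>W\<^esub> \<xi> \<odot>\<^bsub>W\<^esub> w | w. w \<in> carrier W})"


section \<open>Basic facts\<close>

lemma complex_ring_simps [simp]:
  "carrier complex_ring = UNIV" "monoid.mult complex_ring = (*)" "monoid.one complex_ring = 1"
  "ring.zero complex_ring = 0" "ring.add complex_ring = (+)"
  by (simp_all add: ring_of_type_algebra_def fun_eq_iff)

lemma module_complexI:
  assumes "abelian_group V"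
    and "\<And>c x. x \<in> carrier V \<Longrightarrow> c \<odot>\<^bsub>V\<^esub> x \<in> carrier V"
    and "\<And>a b x. x \<in> carrier V \<Longrightarrow> (a + b) \<odot>\<^bsub>V\<^esub> x = a \<odot>\<^bsub>V\<^esub> x \<oplus>\<^bsub>V\<^esub> b \<odot>\<^bsub>V\<^esub> x"
    and "\<And>a x y. \<lbrakk>x \<in> carrier V; y \<in> carrier V\<rbrakk> \<Longrightarrow> a \<odot>\<^bsub>V\<^esub> (x \<oplus>\<^bsub>V\<^esub> y) = a \<odot>\<^bsub>V\<^esub> x \<oplus>\<^bsub>V\<^esub> a \<odot>\<^bsub>V\<^esub> y"
    and "\<And>a b x. x \<in> carrier V \<Longrightarrow> (a * b) \<odot>\<^bsub>V\<^esub> x = a \<odot>\<^bsub>V\<^esub> (b \<odot>\<^bsub>V\<^esub> x)"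
    and "\<And>x. x \<in> carrier V \<Longrightarrow> 1 \<odot>\<^bsub>V\<^esub> x = x"
  shows "module complex_ring V"
  by (rule moduleI) (use assms cring_from_type_algebra in auto)

lemma sv_bracket_linear:
  "sv_bracket (x + y) z = sv_bracket x z + sv_bracket y z"
  "sv_bracket x (y + z) = sv_bracket x y + sv_bracket x z"
  "sv_bracket (fscale c x) y = fscale c (sv_bracket x y)"
  "sv_bracket x (fscale c y) = fscale c (sv_bracket x y)"
  "sv_bracket (basis_vec a) (basis_vec b) = sv_basis_bracket a b"
  "sv_bracket 0 x = 0" "sv_bracket x 0 = 0"
  unfolding sv_bracket_def
  by (simp_all add: lin_ext_add lin_ext_scale lin_ext_add_fun lin_ext_scale_fun)
    (simp_all add: lin_ext_def)

lemma sv_bracket_uminus: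
  "sv_bracket (- x) y = - sv_bracket x y" "sv_bracket x (- y) = - sv_bracket x y"
  using sv_bracket_linear(3)[of "-1" x y] sv_bracket_linear(4)[of x "-1" y] by simp_all

lemma sv_bracket_anti: "sv_bracket x y = - sv_bracket y x"
proof (induction x rule: fvs_induct)
  case (basis a)
  show ?case
  proof (induction y rule: fvs_induct)
    case (basis b)
    show ?case
      by (rule poly_mapping_eqI, cases a; cases b)
        (simp_all add: sv_bracket_linear add_ac, simp_all add: algebra_simps)
  qed (simp_all add: sv_bracket_linear)
qed (simp_all add: sv_bracket_linear)

lemma sv_jacobi:
  "sv_bracket x (sv_bracket y z) + sv_bracket y (sv_bracket z x) + sv_bracket z (sv_bracket x y) = 0"
  (is "?J x y z = 0")
proof -
  have add: "?J (p + q) y z = ?J p y z + ?J q y z" "?J x (p + q) z = ?J x p z + ?J x q z"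
    "?J x y (p + q) = ?J x y p + ?J x y q" for p q x y z
    by (simp_all only: sv_bracket_linear add_ac)
  have scale: "?J (fscale c p) y z = fscale c (?J p y z)" "?J x (fscale c p) z = fscale c (?J x p z)"
    "?J x y (fscale c p) = fscale c (?J x y p)" for c p x y z
    by (simp_all only: sv_bracket_linear fvs.scale_right_distrib)
  have zero: "?J 0 y z = 0" "?J x 0 z = 0" "?J x y 0 = 0" for x y z
    by (simp_all add: sv_bracket_linear)
  have basis: "?J (basis_vec a) (basis_vec b) (basis_vec c) = 0" for a b c
    by (rule poly_mapping_eqI, cases a; cases b; cases c)
      (simp_all add: sv_bracket_linear sv_bracket_uminus lookup_add add_ac,
        simp_all add: lookup_add lookup_minus field_simps)
  have 1: "?J (basis_vec a) (basis_vec b) z = 0" for a b z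
    by (induction z rule: fvs_induct) (simp_all only: zero basis add scale fvs.scale_zero_right add_0_left)
  have 2: "?J (basis_vec a) y z = 0" for a y z
    by (induction y rule: fvs_induct) (simp_all only: zero 1 add scale fvs.scale_zero_right add_0_left)
  show ?thesis
    by (induction x rule: fvs_induct) (simp_all only: zero 2 add scale fvs.scale_zero_right add_0_left)
qed

lemma sv_bracket_self: "sv_bracket x x = 0"
proof (rule poly_mapping_eqI)
  fix k
  have "Poly_Mapping.lookup (sv_bracket x x) k = - Poly_Mapping.lookup (sv_bracket x x) k"
    by (subst (1) sv_bracket_anti) simp
  then show "Poly_Mapping.lookup (sv_bracket x x) k = Poly_Mapping.lookup 0 k"
    by simp
qed

lemma module_fvs:
  assumes "fvs.subspace A"
  shows "module complex_ring
    \<lparr>carrier = A, monoid.mult = m, monoid.one = e, ring.zero = 0,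
      ring.add = (+), module.smult = fscale, \<dots> = r\<rparr>"
    (is "module _ ?V")
proof (rule module_complexI)
  show "abelian_group ?V"
  proof (rule abelian_groupI)
    fix x assume "x \<in> carrier ?V"
    then show "\<exists>y\<in>carrier ?V. y \<oplus>\<^bsub>?V\<^esub> x = \<zero>\<^bsub>?V\<^esub>"
      using assms by (auto intro!: bexI[of _ "- x"] fvs.subspace_neg)
  qed (use assms in \<open>auto simp: add_ac fvs.subspace_0 fvs.subspace_add\<close>)
qed (use assms in \<open>auto simp: fvs.subspace_scale fvs.scale_left_distrib fvs.scale_right_distrib\<close>)

lemma lie_algebra_sv: "lie_algebra sv"
proof -
  have "module complex_ring sv"
    unfolding sv_def by (rule module_fvs) (rule fvs.subspace_UNIV)
  then show ?thesis
    by (intro lie_algebra.intro lie_algebra_axioms.intro)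
      (auto simp: sv_def sv_bracket_linear sv_bracket_self sv_jacobi)
qed

lemma sv_plus_bracket_closed:
  assumes "x \<in> carrier sv_plus" "y \<in> carrier sv_plus"
  shows "sv_bracket x y \<in> carrier sv_plus"
proof -
  let ?B = "{basis_vec (L n) | n. n \<ge> 1} \<union> {basis_vec (M n) | n. n \<ge> 1} \<union> {basis_vec (Y m) | m. m \<ge> 0}"
  have sp: "fvs.subspace (carrier sv_plus)"
    by (simp add: sv_plus_def fvs.subspace_span)
  have base: "basis_vec (L n) \<in> carrier sv_plus" "basis_vec (M n) \<in> carrier sv_plus" if "n \<ge> 1" for n
    using that by (auto simp: sv_plus_def intro!: fvs.span_base)
  have baseY: "basis_vec (Y n) \<in> carrier sv_plus" if "n \<ge> 0" for n
    using that by (auto simp: sv_plus_def intro!: fvs.span_base)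
  have gens: "sv_bracket a b \<in> carrier sv_plus" if "a \<in> ?B" "b \<in> ?B" for a b
    using that
    by (auto simp: sv_bracket_linear simp del: fvs.scale_minus_left
        intro!: fvs.subspace_scale[OF sp] fvs.subspace_0[OF sp] base baseY)
  have xy: "x \<in> fspan ?B" "y \<in> fspan ?B"
    using assms by (auto simp: sv_plus_def)
  note cl = fvs.subspace_0[OF sp] fvs.subspace_add[OF sp] fvs.subspace_scale[OF sp]
  have *: "sv_bracket x b \<in> carrier sv_plus" if b: "b \<in> ?B" for b
    using xy(1)
  proof (induction rule: fvs.span_induct_alt)
    case base
    show ?case using cl by (simp add: sv_bracket_linear)
  next
    case (step c a p)
    show ?case
      unfolding sv_bracket_linear by (intro cl gens[OF step(1) b] step(2))
  qed
  show ?thesis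
    using xy(2)
  proof (induction rule: fvs.span_induct_alt)
    case base
    show ?case using cl by (simp add: sv_bracket_linear)
  next
    case (step c b p)
    show ?case
      unfolding sv_bracket_linear by (intro cl *[OF step(1)] step(2))
  qed
qed

lemma lie_algebra_sv_plus: "lie_algebra sv_plus"
proof -
  have "module complex_ring sv_plus"
    unfolding sv_plus_def sv_def
    by (simp, rule module_fvs) (rule fvs.subspace_span)
  moreover have "bracket sv_plus = sv_bracket" "module.smult sv_plus = fscale" "ring.add sv_plus = (+)" "\<zero>\<^bsub>sv_plus\<^esub> = 0"
    by (simp_all add: sv_plus_def sv_def)
  ultimately show ?thesis
    by (intro lie_algebra.intro lie_algebra_axioms.intro)
      (auto simp: sv_bracket_linear sv_bracket_self sv_jacobi sv_plus_bracket_closed)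
qed

lemma lie_module_one_dim:
  assumes "lie_hom sv_plus complex_lie \<psi>"
  shows "lie_module sv_plus (one_dim_module \<psi>)"
proof -
  have ab: "abelian_group (one_dim_module \<psi>)"
    by (rule abelian_groupI) (auto simp: one_dim_module_def intro: exI[of _ "- _"])
  then have "module complex_ring (one_dim_module \<psi>)"
    by (rule module_complexI) (auto simp: one_dim_module_def algebra_simps)
  moreover have "\<alpha> \<ominus>\<^bsub>one_dim_module \<psi>\<^esub> \<alpha> = 0" for \<alpha>
    using abelian_group.r_neg[OF ab, of \<alpha>] by (simp add: a_minus_def one_dim_module_def)
  ultimately show ?thesis
    using lie_algebra_sv_plus assms
    by (intro lie_module.intro lie_module_axioms.intro)
      (auto simp: lie_hom_def complex_lie_def one_dim_module_def algebra_simps)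
qed

lemma ring_free_alg: "ring (free_alg A)"
proof (rule ringI)
  have letters: "set (letters (v + w)) = set (letters v) \<union> set (letters w)" for v w :: "'a word"
    by (simp add: plus_word_def)
  show "abelian_group (free_alg A)"
  proof (rule abelian_groupI)
    fix x assume "x \<in> carrier (free_alg A)"
    then show "\<exists>y\<in>carrier (free_alg A). y \<oplus>\<^bsub>free_alg A\<^esub> x = \<zero>\<^bsub>free_alg A\<^esub>"
      by (auto simp: free_alg_def intro!: exI[of _ "- x"])
  qed (use Poly_Mapping.keys_add in \<open>fastforce simp: free_alg_def add_ac\<close>)+
  show "Group.monoid (free_alg A)"
  proof (rule monoidI)
    fix x y assume "x \<in> carrier (free_alg A)" "y \<in> carrier (free_alg A)"
    then show "x \<otimes>\<^bsub>free_alg A\<^esub> y \<in> carrier (free_alg A)"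
      using keys_mult[of x y] by (fastforce simp: free_alg_def letters)
  qed (auto simp: free_alg_def mult.assoc zero_word_def split: if_splits)
qed (auto simp: free_alg_def algebra_simps)

end

theory Submission
  imports Defs "HOL-Computational_Algebra.Fundamental_Theorem_Algebra"
begin

text \<open>
Let \<open>F\<close> be the free algebra on \<open>sv\<close>. The map \<open>p \<mapsto> p w\<close>, for a Whittaker vector \<open>w\<close> generating \<open>S\<close>,
presents \<open>S\<close> as \<open>F/J\<close> for a left ideal \<open>J\<close>; likewise \<open>L\<^bsub>\<psi>,\<xi>\<^esub> = F/K\<close>. The two modules are isomorphic
if \<open>J = K\<close>. By construction \<open>K\<close> is the least left ideal that contains the relations of \<open>U(sv)\<close>, the
elements \<open>x - \<psi>(x)\<close> for \<open>x\<close> in \<open>sv\<^sup>+\<close>, and \<open>M\<^sub>0 - \<xi>\<close> (\<open>annihilator_universal\<close>). So two facts are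
needed: \<open>M\<^sub>0\<close> acts on \<open>S\<close> by some scalar \<open>\<xi>\<close>, which gives \<open>K \<subseteq> J\<close>, and \<open>F/K\<close> has no proper nonzero
submodule, which gives \<open>J \<subseteq> K\<close>.

Both come from one computation of Whittaker vectors. Grade \<open>sv\<close> by letting \<open>L\<^sub>n\<close>, \<open>Y\<close> with subscript
\<open>n + 1/2\<close>, and \<open>M\<^sub>n\<close> have degrees \<open>n\<close>, \<open>n + 3/2\<close> and \<open>n + 2\<close>. A character \<open>\<psi>\<close> of \<open>sv\<^sup>+\<close> vanishes in
degrees above \<open>3\<close>, and in degree \<open>3\<close> it is carried by \<open>M\<^sub>1\<close> alone. Each creation generator \<open>a\<close> (a basis
vector outside \<open>sv\<^sup>+\<close> other than \<open>M\<^sub>0\<close>) has a dual \<open>a*\<close> in \<open>sv\<^sup>+\<close> such that \<open>[a*, b]\<close> is a nonzero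
multiple of \<open>M\<^sub>1\<close> for \<open>b = a\<close> and has no \<open>M\<^sub>1\<close> component for all other creation generators \<open>b\<close>: \<open>L\<^sub>n\<close> and
\<open>M\<^bsub>1-n\<^esub>\<close> are dual to each other, and so are the \<open>Y\<close> with subscripts \<open>1/2 + n\<close> and \<open>1/2 - n\<close>. Filter a
Whittaker module by words in the creation generators, where the letter \<open>a\<close> has weight \<open>3 - 2 deg a > 0\<close>.
Since \<open>M\<^sub>1\<close> acts by \<open>\<psi>(M\<^sub>1) \<noteq> 0\<close> to leading order, \<open>a* - \<psi>(a*)\<close> acts, up to a nonzero factor and terms
of lower weight, as the partial derivative by \<open>a\<close>. Hence a suitable combination of the operators
\<open>a (a* - \<psi>(a*))\<close> is an Euler operator: it multiplies by \<open>s\<close> in weight \<open>s\<close>, modulo lower weight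
(\<open>euler_filt\<close>). A vector killed by all \<open>a* - \<psi>(a*)\<close> is thus of weight \<open>0\<close>, that is, in \<open>\<complex>[M\<^sub>0] w\<close>
(\<open>whittaker_vector_in_base\<close>). This argument uses only that the words span, not that they are
independent, so the Poincare-Birkhoff-Witt theorem is not involved.

If \<open>M\<^sub>0\<close> acts by a scalar, a nonzero vector of least weight in a submodule is killed by all
\<open>a* - \<psi>(a*)\<close>, which lower the weight; so it is a multiple of \<open>w\<close> (\<open>simple_quotient\<close>). For a simple
module, if \<open>M\<^sub>0\<close> is not zero, it is invertible and \<open>M\<^sub>0\<^sup>-\<^sup>1 w\<close> is a Whittaker vector, so
\<open>M\<^sub>0\<^sup>-\<^sup>1 w = g(M\<^sub>0) w\<close> for a polynomial \<open>g\<close>. Then \<open>M\<^sub>0\<close> satisfies a polynomial equation over \<open>\<complex>\<close>, and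
simplicity leaves it one eigenvalue \<open>\<xi>\<close> (\<open>central_character\<close>).
\<close>

section \<open>Free associative algebras\<close>

type_synonym free_sv = "sv word \<Rightarrow>\<^sub>0 complex"

lemma fscale_eq_mult: "fscale c (p :: 'b::monoid_add \<Rightarrow>\<^sub>0 complex) = Poly_Mapping.single 0 c * p"
  by (simp add: fscale_def mult_map_scale_conv_mult)

lemma single_zero_commutes:
  "p * Poly_Mapping.single 0 c = Poly_Mapping.single 0 c * (p :: 'b::monoid_add \<Rightarrow>\<^sub>0 complex)"
proof (induction p rule: fvs_induct)
  case (scale d p)
  have "Poly_Mapping.single 0 d * (Poly_Mapping.single 0 c * p)
      = Poly_Mapping.single 0 c * (Poly_Mapping.single 0 d * p)"
    by (simp add: mult_single mult.commute flip: mult.assoc)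
  then show ?case
    by (simp add: fscale_eq_mult scale mult.assoc)
qed (simp_all add: basis_vec_def mult_single algebra_simps)

lemma fscale_mult_left [simp]:
  "fscale c p * q = fscale c (p * q :: 'b::monoid_add \<Rightarrow>\<^sub>0 complex)"
  by (simp add: fscale_eq_mult mult.assoc)

lemma fscale_mult_right [simp]:
  "p * fscale c q = fscale c (p * q :: 'b::monoid_add \<Rightarrow>\<^sub>0 complex)"
proof -
  have "p * (Poly_Mapping.single 0 c * q) = (p * Poly_Mapping.single 0 c) * q"
    by (simp only: mult.assoc)
  also have "\<dots> = Poly_Mapping.single 0 c * (p * q)"
    by (simp only: single_zero_commutes mult.assoc)
  finally show ?thesis
    by (simp only: fscale_eq_mult)
qed

lemma basis_vec_word_Cons: "basis_vec (Word (x # xs)) = letter x * basis_vec (Word xs)"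
  by (simp add: letter_def basis_vec_def mult_single plus_word_def)

lemma basis_vec_word_Nil: "basis_vec (Word []) = 1"
  by (simp add: basis_vec_def flip: zero_word_def)

lemma free_alg_UNIV [simp]: "carrier (free_alg UNIV) = UNIV"
  and free_alg_ops [simp]: "monoid.mult (free_alg A) = (*)" "ring.add (free_alg A) = (+)"
    "\<zero>\<^bsub>free_alg A\<^esub> = 0" "\<one>\<^bsub>free_alg A\<^esub> = 1"
  by (simp_all add: free_alg_def)

lemma lin_ext_basis_vec: "lin_ext basis_vec p = p"
  by (induction p rule: fvs_induct) (simp_all add: lin_ext_add lin_ext_scale)

text \<open>Subspaces spanned by a set of basis vectors occur as carriers of free algebras and of free spaces;
this is linear induction inside them.\<close>

lemma keys_induct [consumes 1, case_names zero basis add scale]: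
  assumes "Poly_Mapping.keys p \<subseteq> A" and "P 0" "\<And>b. b \<in> A \<Longrightarrow> P (basis_vec b)"
    and "\<And>p q. \<lbrakk>P p; P q\<rbrakk> \<Longrightarrow> P (p + q)" "\<And>c p. P p \<Longrightarrow> P (fscale c p)"
  shows "P p"
proof -
  have sum: "P (\<Sum>b\<in>K. fscale (f b) (basis_vec b))" if "finite K" "K \<subseteq> A" for K f
    using that by (induction K) (auto intro: assms)
  have "P (lin_ext basis_vec p)"
    unfolding lin_ext_def by (rule sum[OF finite_keys assms(1)])
  then show ?thesis
    by (simp add: lin_ext_basis_vec)
qed

lemma subspace_keys: "fvs.subspace {p. Poly_Mapping.keys p \<subseteq> A}"
proof (rule fvs.subspaceI)
  fix p q :: "'a \<Rightarrow>\<^sub>0 complex" and c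
  assume p: "p \<in> {p. Poly_Mapping.keys p \<subseteq> A}"
  show "fscale c p \<in> {p. Poly_Mapping.keys p \<subseteq> A}"
    using p by (auto simp: in_keys_iff)
  assume "q \<in> {p. Poly_Mapping.keys p \<subseteq> A}"
  with p show "p + q \<in> {p. Poly_Mapping.keys p \<subseteq> A}"
    using Poly_Mapping.keys_add[of p q] by blast
qed simp

lemma carrier_free_alg: "carrier (free_alg A) = {p. Poly_Mapping.keys p \<subseteq> {w. set (letters w) \<subseteq> A}}"
  by (auto simp: free_alg_def)

lemma free_alg_carrier_induct [consumes 1, case_names zero one letter add scale]:
  assumes p: "p \<in> carrier (free_alg A)"
    and P: "P 0" "P 1" "\<And>x p. \<lbrakk>x \<in> A; p \<in> carrier (free_alg A); P p\<rbrakk> \<Longrightarrow> P (letter x * p)"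
    "\<And>p q. \<lbrakk>p \<in> carrier (free_alg A); q \<in> carrier (free_alg A); P p; P q\<rbrakk> \<Longrightarrow> P (p + q)"
    "\<And>c p. \<lbrakk>p \<in> carrier (free_alg A); P p\<rbrakk> \<Longrightarrow> P (fscale c p)"
  shows "P p"
proof -
  let ?C = "carrier (free_alg A)"
  have sp: "fvs.subspace ?C"
    unfolding carrier_free_alg by (rule subspace_keys)
  have word: "basis_vec (Word xs) \<in> ?C \<and> P (basis_vec (Word xs))" if "set xs \<subseteq> A" for xs
    using that
  proof (induction xs)
    case Nil
    then show ?case
      using P(2) by (simp add: basis_vec_word_Nil carrier_free_alg zero_word_def)
  next
    case (Cons x xs)
    have "basis_vec (Word (x # xs)) \<in> ?C"
      using Cons.prems by (simp add: carrier_free_alg basis_vec_def)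
    then show ?case
      using Cons P(3) by (simp add: basis_vec_word_Cons)
  qed
  have "p \<in> ?C \<and> P p"
    using p unfolding carrier_free_alg[of A] mem_Collect_eq
  proof (induction p rule: keys_induct)
    case (basis b)
    then show ?case
      using word[of "letters b"] by (simp add: carrier_free_alg)
  next
    case (add p q)
    then show ?case
      using P(4) fvs.subspace_add[OF sp] by (simp add: carrier_free_alg)
  next
    case (scale c p)
    then show ?case
      using P(5) fvs.subspace_scale[OF sp] by (simp add: carrier_free_alg)
  qed (use P in simp_all)
  then show ?thesis ..
qed

lemma free_alg_induct [case_names zero one letter add scale]:
  fixes p :: "'g word \<Rightarrow>\<^sub>0 complex"
  assumes "P 0" "P 1" "\<And>x p. P p \<Longrightarrow> P (letter x * p)"
    and "\<And>p q. \<lbrakk>P p; P q\<rbrakk> \<Longrightarrow> P (p + q)" "\<And>c p. P p \<Longrightarrow> P (fscale c p)"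
  shows "P p"
  by (rule free_alg_carrier_induct[of p UNIV]) (simp_all add: assms)

lemma free_alg_closed:
  "letter x \<in> carrier (free_alg A) \<longleftrightarrow> x \<in> A"
  "p \<in> carrier (free_alg A) \<Longrightarrow> fscale c p \<in> carrier (free_alg A)"
  "\<lbrakk>p \<in> carrier (free_alg A); q \<in> carrier (free_alg A)\<rbrakk> \<Longrightarrow> p + q \<in> carrier (free_alg A)"
  "\<lbrakk>p \<in> carrier (free_alg A); q \<in> carrier (free_alg A)\<rbrakk> \<Longrightarrow> p * q \<in> carrier (free_alg A)"
  "0 \<in> carrier (free_alg A)" "1 \<in> carrier (free_alg A)"
proof -
  interpret ring "free_alg A" by (rule ring_free_alg)
  show "p + q \<in> carrier (free_alg A)" if "p \<in> carrier (free_alg A)" "q \<in> carrier (free_alg A)"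
    using a_closed[OF that] by simp
  show "p * q \<in> carrier (free_alg A)" if "p \<in> carrier (free_alg A)" "q \<in> carrier (free_alg A)"
    using m_closed[OF that] by simp
  show "0 \<in> carrier (free_alg A)" "1 \<in> carrier (free_alg A)"
    using zero_closed one_closed by simp_all
qed (auto simp: carrier_free_alg letter_def basis_vec_def in_keys_iff)

lemma free_alg_diff_closed:
  "\<lbrakk>p \<in> carrier (free_alg A); q \<in> carrier (free_alg A)\<rbrakk> \<Longrightarrow> p - q \<in> carrier (free_alg A)"
  unfolding carrier_free_alg by (rule fvs.subspace_diff[OF subspace_keys])

lemma free_alg_idealI:
  assumes sub: "K \<subseteq> carrier (free_alg A)" and zero: "0 \<in> K"
    and add: "\<And>p q. \<lbrakk>p \<in> K; q \<in> K\<rbrakk> \<Longrightarrow> p + q \<in> K"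
    and left: "\<And>p q. \<lbrakk>p \<in> K; q \<in> carrier (free_alg A)\<rbrakk> \<Longrightarrow> q * p \<in> K"
    and right: "\<And>p q. \<lbrakk>p \<in> K; q \<in> carrier (free_alg A)\<rbrakk> \<Longrightarrow> p * q \<in> K"
  shows "ideal K (free_alg A)"
proof -
  interpret F: ring "free_alg A" by (rule ring_free_alg)
  have "subgroup K (add_monoid (free_alg A))"
  proof (rule F.add.subgroupI)
    fix p assume p: "p \<in> K"
    then have "p \<in> carrier (free_alg A)" "0 - p \<in> carrier (free_alg A)"
      using sub free_alg_diff_closed[OF free_alg_closed(5)] by blast+
    then have "\<ominus>\<^bsub>free_alg A\<^esub> p = 0 - p"
      using F.minus_equality[of "0 - p" p] by simp
    moreover have "fscale (-1) 1 * p \<in> K"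
      by (intro left p free_alg_closed)
    ultimately show "\<ominus>\<^bsub>free_alg A\<^esub> p \<in> K"
      by simp
    fix q assume "q \<in> K"
    with p show "p \<oplus>\<^bsub>free_alg A\<^esub> q \<in> K"
      by (simp add: add)
  qed (use sub zero in auto)
  then show ?thesis
    by (intro idealI[OF F.ring_axioms]) (simp_all add: left right)
qed


section \<open>The defining ideal of the enveloping algebra\<close>

lemma carrier_sv [simp]: "carrier sv = UNIV" and sv_add [simp]: "ring.add sv = (+)"
  and sv_smult [simp]: "module.smult sv = fscale" and sv_bracket_field [simp]: "bracket sv = sv_bracket"
  by (simp_all add: sv_def)

abbreviation I_sv :: "free_sv set" where "I_sv \<equiv> uea_ideal sv"

lemma uea_relations_closed:
  assumes "lie_algebra G" shows "uea_relations G \<subseteq> carrier (free_alg (carrier G))"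
proof -
  interpret lie_algebra G by fact
  show ?thesis
    unfolding uea_relations_def
    by (auto intro!: free_alg_closed free_alg_diff_closed simp: free_alg_closed(1) bracket_closed)
qed

lemma uea_ideal_ideal: "lie_algebra G \<Longrightarrow> ideal (uea_ideal G) (free_alg (carrier G))"
  unfolding uea_ideal_def by (rule ring.genideal_ideal[OF ring_free_alg uea_relations_closed])

lemma uea_relations_in_ideal: "lie_algebra G \<Longrightarrow> uea_relations G \<subseteq> uea_ideal G"
  unfolding uea_ideal_def by (rule ring.genideal_self[OF ring_free_alg uea_relations_closed])

lemma uea_ideal_minimal:
  assumes "ideal K (free_alg (carrier G))" "uea_relations G \<subseteq> K"
  shows "uea_ideal G \<subseteq> K"
  unfolding uea_ideal_def by (rule ring.genideal_minimal[OF ring_free_alg assms])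

lemma I_sv_zero [simp]: "0 \<in> I_sv"
  and I_sv_add: "\<lbrakk>p \<in> I_sv; q \<in> I_sv\<rbrakk> \<Longrightarrow> p + q \<in> I_sv"
  and I_sv_mult_left: "p \<in> I_sv \<Longrightarrow> q * p \<in> I_sv"
  and I_sv_mult_right: "p \<in> I_sv \<Longrightarrow> p * q \<in> I_sv"
proof -
  interpret ideal I_sv "free_alg UNIV"
    using uea_ideal_ideal[OF lie_algebra_sv] by simp
  show "0 \<in> I_sv" using additive_subgroup.zero_closed[OF is_additive_subgroup] by simp
  show "\<lbrakk>p \<in> I_sv; q \<in> I_sv\<rbrakk> \<Longrightarrow> p + q \<in> I_sv" using additive_subgroup.a_closed[OF is_additive_subgroup, of p q] by simp
  show "p \<in> I_sv \<Longrightarrow> q * p \<in> I_sv" using I_l_closed[of p q] by simp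
  show "p \<in> I_sv \<Longrightarrow> p * q \<in> I_sv" using I_r_closed[of p q] by simp
qed

lemma I_sv_relations:
  "letter (x + y) - letter x - letter y \<in> I_sv"
  "letter (fscale c x) - fscale c (letter x) \<in> I_sv"
  "letter x * letter y - letter y * letter x - letter (sv_bracket x y) \<in> I_sv"
  by (rule subsetD[OF uea_relations_in_ideal[OF lie_algebra_sv]],
      auto simp: uea_relations_def)+


section \<open>The grading of the Schroedinger-Virasoro algebra\<close>

text \<open>The algebra is graded by giving \<open>L\<^sub>n\<close> degree \<open>n\<close>, \<open>Y\<close> with subscript \<open>n + 1/2\<close> degree \<open>n + 3/2\<close>
and \<open>M\<^sub>n\<close> degree \<open>n + 2\<close>. The weight is \<open>3 - 2 deg\<close>, where the factor \<open>2\<close> avoids fractions. As \<open>M\<^sub>1\<close> has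
degree \<open>3\<close>, the shift gives opposite weights to two basis vectors whose bracket is a multiple of
\<open>M\<^sub>1\<close>; it also makes the weights of all creation generators positive.\<close>

fun wt :: "sv_index \<Rightarrow> int" where
  "wt (L n) = 3 - 2 * n"
| "wt (Y n) = - 2 * n"
| "wt (M n) = - 2 * n - 1"

text \<open>The basis vectors outside \<open>sv\<^sup>+\<close>, without the central \<open>M\<^sub>0\<close>: words in them generate a Whittaker
module from \<open>\<complex>[M\<^sub>0] w\<close>.\<close>

fun creation :: "sv_index \<Rightarrow> bool" where
  "creation (L n) \<longleftrightarrow> n \<le> 0"
| "creation (M n) \<longleftrightarrow> n \<le> -1"
| "creation (Y n) \<longleftrightarrow> n \<le> -1"

fun positive :: "sv_index \<Rightarrow> bool" where
  "positive (L n) \<longleftrightarrow> n \<ge> 1"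
| "positive (M n) \<longleftrightarrow> n \<ge> 1"
| "positive (Y n) \<longleftrightarrow> n \<ge> 0"

text \<open>The partner whose bracket with the given basis vector is a multiple of \<open>M\<^sub>1\<close>. Since \<open>M\<^sub>1\<close> acts on a
Whittaker vector by the nonzero scalar \<open>\<psi>(M\<^sub>1)\<close>, the dual of a creation generator acts, to leading
order, as a multiple of the partial derivative by that generator.\<close>

fun dual :: "sv_index \<Rightarrow> sv_index" where
  "dual (L n) = M (1 - n)"
| "dual (M n) = L (1 - n)"
| "dual (Y n) = Y (- n)"

fun br_coeff :: "sv_index \<Rightarrow> sv_index \<Rightarrow> complex" where
  "br_coeff (L m) (L n) = of_int n - of_int m"
| "br_coeff (L m) (M n) = of_int n"
| "br_coeff (M n) (L m) = - of_int n"
| "br_coeff (L m) (Y n) = of_int n + (1 - of_int m) / 2"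
| "br_coeff (Y n) (L m) = - (of_int n + (1 - of_int m) / 2)"
| "br_coeff (Y m) (Y n) = of_int n - of_int m"
| "br_coeff (M m) (M n) = 0"
| "br_coeff (M m) (Y n) = 0"
| "br_coeff (Y n) (M m) = 0"

text \<open>The bracket of two basis vectors is a multiple of a third. The values for pairs with bracket zero
are arbitrary.\<close>

fun br_index :: "sv_index \<Rightarrow> sv_index \<Rightarrow> sv_index" where
  "br_index (L m) (L n) = L (m + n)"
| "br_index (L m) (M n) = M (m + n)"
| "br_index (M n) (L m) = M (m + n)"
| "br_index (L m) (Y n) = Y (m + n)"
| "br_index (Y n) (L m) = Y (m + n)"
| "br_index (Y m) (Y n) = M (m + n + 1)"
| "br_index (M m) (M n) = M (m + n)"
| "br_index (M m) (Y n) = M (m + n)"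
| "br_index (Y n) (M m) = M (m + n)"

lemma sv_bracket_basis:
  "sv_bracket (basis_vec i) (basis_vec j) = fscale (br_coeff i j) (basis_vec (br_index i j))"
  by (cases i; cases j) (simp_all add: sv_bracket_linear)

text \<open>This is the statement that the bracket is graded, in terms of \<open>3 - 2 deg\<close>.\<close>

lemma wt_br_index: "br_coeff i j \<noteq> 0 \<Longrightarrow> wt (br_index i j) = wt i + wt j - 3"
  by (cases i; cases j) auto

lemma index_cases: "creation k \<or> positive k \<or> k = M 0"
  by (cases k) auto

lemma creation_wt_pos: "creation k \<Longrightarrow> wt k > 0"
  by (cases k) auto

lemma wt_dual: "wt (dual k) = - wt k"
  by (cases k) auto

lemma positive_dual: "creation k \<Longrightarrow> positive (dual k)"
  by (cases k) auto

lemma br_coeff_dual: "creation k \<Longrightarrow> br_coeff (dual k) k \<noteq> 0"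
proof -
  assume k: "creation k"
  have nz: "(of_int z :: complex) \<noteq> 0" if "z \<noteq> 0" for z
    using that by simp
  show "br_coeff (dual k) k \<noteq> 0"
    using k nz[of "case k of L n \<Rightarrow> n - 1 | M n \<Rightarrow> n | Y n \<Rightarrow> 2 * n"] by (cases k) auto
qed

lemma br_index_dual: "br_index (dual k) k = M 1"
  by (cases k) auto

lemma br_index_dual_M1:
  assumes "br_coeff (dual a) b \<noteq> 0" "br_index (dual a) b = M 1"
  shows "a = b"
  using assms by (cases a; cases b) auto

lemma finite_creation: "finite {a. creation a \<and> wt a \<le> s}"
proof (rule finite_subset)
  show "{a. creation a \<and> wt a \<le> s} \<subseteq> L ` {-s..0} \<union> M ` {-s-1..0} \<union> Y ` {-s..0}"
  proof
    fix a assume "a \<in> {a. creation a \<and> wt a \<le> s}"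
    then show "a \<in> L ` {-s..0} \<union> M ` {-s-1..0} \<union> Y ` {-s..0}"
      by (cases a) auto
  qed
qed simp


section \<open>The weight filtration and the Euler operator\<close>

abbreviation gen :: "sv_index \<Rightarrow> free_sv" where "gen k \<equiv> letter (basis_vec k)"

locale left_ideal_sv =
  fixes J :: "free_sv set"
  assumes ideal_sub: "I_sv \<subseteq> J"
    and J_add: "\<lbrakk>p \<in> J; q \<in> J\<rbrakk> \<Longrightarrow> p + q \<in> J"
    and J_mult: "p \<in> J \<Longrightarrow> q * p \<in> J"
begin

lemma J_zero [simp]: "0 \<in> J"
  using ideal_sub by auto

lemma J_scale: "p \<in> J \<Longrightarrow> fscale c p \<in> J"
  using J_mult[of p "fscale c 1"] by simp

lemma J_uminus: "p \<in> J \<Longrightarrow> - p \<in> J"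
  using J_scale[of p "-1"] by simp

lemma J_diff: "\<lbrakk>p \<in> J; q \<in> J\<rbrakk> \<Longrightarrow> p - q \<in> J"
  using J_add[of p "- q"] J_uminus by simp

lemma J_sum: "(\<And>a. a \<in> A \<Longrightarrow> f a \<in> J) \<Longrightarrow> sum f A \<in> J"
  by (induction A rule: infinite_finite_induct) (auto intro: J_add)

lemma J_scale_iff: "c \<noteq> 0 \<Longrightarrow> fscale c p \<in> J \<longleftrightarrow> p \<in> J"
  using J_scale[of p c] J_scale[of "fscale c p" "inverse c"] by auto

lemma J_relations:
  "(letter (x + y) - letter x - letter y) * p \<in> J"
  "(letter (fscale c x) - fscale c (letter x)) * p \<in> J"
  "(letter x * letter y - letter y * letter x - letter (sv_bracket x y)) * p \<in> J"
  using ideal_sub by (blast intro: I_sv_mult_right I_sv_relations)+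

text \<open>Left ideals of the free algebra that contain the defining ideal correspond to left ideals of
\<open>U(sv)\<close>, so two generators may be exchanged at the cost of their bracket.\<close>

lemma commute_mod_J:
  "gen i * (gen j * p) - gen j * (gen i * p) - fscale (br_coeff i j) (gen (br_index i j) * p) \<in> J"
  using J_add[OF J_relations(3)[of "basis_vec i" "basis_vec j" p]
      J_relations(2)[of "br_coeff i j" "basis_vec (br_index i j)" p]]
  by (simp add: sv_bracket_basis algebra_simps)

end

text \<open>The left ideals that annihilate a Whittaker vector. On \<open>\<psi>\<close> only a consequence of the homomorphism
property is recorded: \<open>\<psi>\<close> vanishes in degrees above \<open>3\<close>, and in degree \<open>3\<close> on all basis vectors but
\<open>M\<^sub>1\<close>. Hence \<open>M\<^sub>1\<close> dominates in every weight estimate.\<close>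

locale whittaker_left_ideal = left_ideal_sv +
  fixes \<psi> :: "sv_index \<Rightarrow> complex"
  assumes psi_wt: "\<lbrakk>positive k; \<psi> k \<noteq> 0; k \<noteq> M 1\<rbrakk> \<Longrightarrow> wt k > -3"
    and psi_M1: "\<psi> (M 1) \<noteq> 0"
    and J_whittaker: "positive k \<Longrightarrow> gen k - fscale (\<psi> k) 1 \<in> J"

text \<open>A space \<open>B\<close> of representatives of Whittaker vectors on which the filtration starts. Two choices
matter: \<open>\<complex>[M\<^sub>0] + J\<close>, before \<open>M\<^sub>0\<close> is known to act by a scalar, and \<open>\<complex> + J\<close> afterwards.\<close>

locale whittaker_base = whittaker_left_ideal +
  fixes B :: "free_sv set"
  assumes B_one: "1 \<in> B"
    and B_sub: "J \<subseteq> B"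
    and B_add: "\<lbrakk>p \<in> B; q \<in> B\<rbrakk> \<Longrightarrow> p + q \<in> B"
    and B_scale: "p \<in> B \<Longrightarrow> fscale c p \<in> B"
    and B_M0: "p \<in> B \<Longrightarrow> gen (M 0) * p \<in> B"
    and B_whittaker: "\<lbrakk>p \<in> B; positive k\<rbrakk> \<Longrightarrow> gen k * p - fscale (\<psi> k) p \<in> J"
begin

text \<open>Up to \<open>J\<close>, the step \<open>s\<close> of the filtration consists of words of weight at most \<open>s\<close> in the creation
generators, followed by an element of \<open>B\<close>. The words are not ordered, so that the filtration is
stable under these letters by construction and no basis theorem is involved.\<close>

inductive filt :: "int \<Rightarrow> free_sv \<Rightarrow> bool" where
  filt_J: "p \<in> J \<Longrightarrow> filt s p"
| filt_B: "\<lbrakk>p \<in> B; 0 \<le> s\<rbrakk> \<Longrightarrow> filt s p"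
| filt_add: "\<lbrakk>filt s p; filt s q\<rbrakk> \<Longrightarrow> filt s (p + q)"
| filt_mult: "\<lbrakk>filt s p; creation a; s + wt a \<le> t\<rbrakk> \<Longrightarrow> filt t (gen a * p)"

lemma filt_mono:
  assumes "filt s p" "s \<le> t" shows "filt t p"
  using assms
proof (induction arbitrary: t rule: filt.induct)
  case (filt_mult s p a t t')
  show ?case
    by (rule filt.filt_mult[OF filt_mult.hyps(1,2)]) (use filt_mult in auto)
qed (auto intro: filt.intros)

lemma filt_scale:
  assumes "filt s p" shows "filt s (fscale c p)"
  using assms
proof (induction rule: filt.induct)
  case (filt_mult s p a t)
  have "filt t (gen a * fscale c p)"
    by (rule filt.filt_mult) (use filt_mult in auto)
  then show ?case by simp
qed (auto intro: filt.intros J_scale B_scale simp: fvs.scale_right_distrib)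

lemma filt_uminus: "filt s p \<Longrightarrow> filt s (- p)"
  using filt_scale[of s p "-1"] by simp

lemma filt_diff: "\<lbrakk>filt s p; filt s q\<rbrakk> \<Longrightarrow> filt s (p - q)"
  using filt_add[of s p "- q"] filt_uminus by simp

lemma filt_sum: "(\<And>a. a \<in> A \<Longrightarrow> filt s (f a)) \<Longrightarrow> filt s (sum f A)"
  by (induction A rule: infinite_finite_induct) (auto intro: filt.intros)

lemma filt_mod_J: "\<lbrakk>filt s q; p - q \<in> J\<rbrakk> \<Longrightarrow> filt s p"
  using filt_add[OF _ filt_J, of s q "p - q"] by simp

lemma filt_negative:
  assumes "filt s p" "s < 0" shows "p \<in> J"
  using assms
  by (induction rule: filt.induct) (auto intro!: J_add J_mult dest: creation_wt_pos)

lemma filt_zero: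
  assumes "filt s p" "s \<le> 0" shows "p \<in> B"
  using assms
proof (induction rule: filt.induct)
  case (filt_mult s p a t)
  then have "p \<in> J"
    using filt_negative creation_wt_pos by fastforce
  then show ?case
    using B_sub J_mult by auto
qed (use B_sub in \<open>auto intro: B_add\<close>)

lemma filt_M0:
  assumes "filt s p" shows "filt s (gen (M 0) * p)"
  using assms
proof (induction rule: filt.induct)
  case (filt_mult s p a t)
  have c: "br_coeff (M 0) a = 0"
    by (cases a) auto
  have "filt t (gen a * (gen (M 0) * p))"
    by (rule filt.filt_mult) (use filt_mult in auto)
  then show ?case
    by (rule filt_mod_J) (use commute_mod_J[of "M 0" a p] c in simp)
qed (auto intro: filt.intros J_mult B_M0 simp: algebra_simps)

text \<open>Move the positive generator \<open>k\<close> through the word, where \<open>k - \<psi>(k)\<close> kills \<open>B\<close> at the end. Passing a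
letter \<open>a\<close> replaces the two by a generator \<open>m\<close> of weight \<open>wt k + wt a - 3\<close>. The loss of \<open>3\<close> pays for
the scalar \<open>\<psi>(m)\<close>, which has to be counted with weight \<open>0\<close>: it can be nonzero only if \<open>m\<close> has
weight at least \<open>-3\<close>.\<close>

lemma filt_twisted:
  assumes "filt s p" "positive k"
  shows "filt (s + wt k) (gen k * p - fscale (\<psi> k) p)"
  using assms
proof (induction arbitrary: k rule: filt.induct)
  case (filt_J p s)
  then show ?case by (auto intro!: filt.filt_J J_diff J_mult J_scale)
next
  case (filt_B p s)
  then show ?case by (auto intro!: filt.filt_J B_whittaker)
next
  case (filt_add s p q)
  have "filt (s + wt k) ((gen k * p - fscale (\<psi> k) p) + (gen k * q - fscale (\<psi> k) q))"
    by (rule filt.filt_add) (use filt_add in auto)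
  then show ?case by (simp add: algebra_simps)
next
  case (filt_mult s p a t)
  let ?m = "br_index k a" and ?c = "br_coeff k a"
  have "filt (t + wt k) (fscale ?c (gen ?m * p))"
  proof (cases "?c = 0")
    case False
    then have wt: "wt ?m = wt k + wt a - 3"
      by (rule wt_br_index)
    consider "creation ?m" | "positive ?m" | "?m = M 0"
      using index_cases by blast
    then have "filt (t + wt k) (gen ?m * p)"
    proof cases
      case 1
      then show ?thesis
        by (rule filt.filt_mult[OF filt_mult.hyps(1)]) (use wt filt_mult.hyps(3) in auto)
    next
      case 2
      have "filt (t + wt k) (gen ?m * p - fscale (\<psi> ?m) p)"
        by (rule filt_mono[OF filt_mult.IH[OF 2]]) (use wt filt_mult.hyps in simp)
      moreover have "filt (t + wt k) (fscale (\<psi> ?m) p)"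
      proof (cases "\<psi> ?m = 0")
        case False
        then have "wt ?m \<ge> -3"
          using psi_wt[OF 2] by (cases "?m = M 1") auto
        then show ?thesis
          by (intro filt_scale filt_mono[OF filt_mult.hyps(1)]) (use wt filt_mult.hyps in simp)
      qed (simp add: filt_J)
      ultimately show ?thesis
        using filt_add by fastforce
    next
      case 3
      then show ?thesis
        using filt_mono[OF filt_M0[OF filt_mult.hyps(1)]] wt filt_mult.hyps by simp
    qed
    then show ?thesis
      by (rule filt_scale)
  qed (simp add: filt_J)
  moreover have "filt (t + wt k) (gen a * (gen k * p - fscale (\<psi> k) p))"
    by (rule filt.filt_mult[OF filt_mult.IH[OF filt_mult.prems]]) (use filt_mult in auto)
  ultimately have "filt (t + wt k) (fscale ?c (gen ?m * p) + gen a * (gen k * p - fscale (\<psi> k) p))"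
    by (rule filt_add)
  then show ?case
    by (rule filt_mod_J) (use commute_mod_J[of k a p] in \<open>simp add: algebra_simps\<close>)
qed

lemma filt_M1: "filt s p \<Longrightarrow> filt (s - 3) (gen (M 1) * p - fscale (\<psi> (M 1)) p)"
  using filt_twisted[of s p "M 1"] by simp

text \<open>Compared with \<open>filt_twisted\<close> the weight is larger by \<open>2\<close>, because \<open>\<psi>(k)\<close> is no longer subtracted and
\<open>M\<^sub>0\<close> counts with weight \<open>0\<close> although \<open>wt (M 0) = -1\<close>. As brackets lose \<open>3\<close>, one unit is still
gained; for \<open>M\<^sub>1\<close> there is no gain, which is why it carries the leading term.\<close>

lemma filt_act:
  assumes "filt s p" "k \<noteq> M 1"
  shows "filt (s + wt k + 2) (gen k * p)"
proof -
  consider "creation k" | "positive k" | "k = M 0"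
    using index_cases by blast
  then show ?thesis
  proof cases
    case 1
    then show ?thesis
      by (rule filt.filt_mult[OF assms(1)]) simp
  next
    case 2
    have "filt (s + wt k + 2) (gen k * p - fscale (\<psi> k) p)"
      by (rule filt_mono[OF filt_twisted[OF assms(1) 2]]) simp
    moreover have "filt (s + wt k + 2) (fscale (\<psi> k) p)"
    proof (cases "\<psi> k = 0")
      case False
      then show ?thesis
        using psi_wt[OF 2 _ assms(2)] by (intro filt_scale filt_mono[OF assms(1)]) simp
    qed (simp add: filt_J)
    ultimately show ?thesis
      using filt_add by fastforce
  next
    case 3
    then show ?thesis
      using filt_mono[OF filt_M0[OF assms(1)]] by simp
  qed
qed

lemma filt_exhaustive: "\<exists>s. filt s p"
proof -
  have act: "\<exists>t. filt t (gen k * p)" if p: "filt s p" for k s p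
  proof (cases "k = M 1")
    case True
    have "filt s (gen (M 1) * p - fscale (\<psi> (M 1)) p)"
      by (rule filt_mono[OF filt_M1[OF p]]) simp
    then have "filt s (gen (M 1) * p)"
      using filt_add[OF _ filt_scale[OF p, of "\<psi> (M 1)"]] by force
    then show ?thesis
      using True by auto
  qed (use filt_act[OF p] in blast)
  have add: "\<exists>s. filt s (p + q)" if "\<exists>s. filt s p" "\<exists>s. filt s q" for p q
    using that filt_add filt_mono by (metis linorder_le_cases)
  show ?thesis
  proof (induction p rule: free_alg_induct)
    case (letter x p)
    then obtain s where s: "filt s p" by blast
    show ?case
    proof (induction x rule: fvs_induct)
      case zero
      have "letter 0 * p \<in> J"
        using J_relations(1)[of 0 0 p] J_uminus[of "letter 0 * p"] J_uminus[of "- (letter 0 * p)"] by simp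
      then show ?case by (auto intro: filt_J)
    next
      case (basis k)
      show ?case by (rule act[OF s])
    next
      case (add x y)
      then obtain t where "filt t (letter x * p + letter y * p)"
        using \<open>\<And>q p. \<lbrakk>\<exists>s. filt s p; \<exists>s. filt s q\<rbrakk> \<Longrightarrow> \<exists>s. filt s (p + q)\<close> by blast
      then have "filt t (letter (x + y) * p)"
        by (rule filt_mod_J) (use J_relations(1)[of x y p] in \<open>simp add: algebra_simps\<close>)
      then show ?case ..
    next
      case (scale c x)
      then obtain t where "filt t (fscale c (letter x * p))"
        using filt_scale by blast
      then have "filt t (letter (fscale c x) * p)"
        by (rule filt_mod_J) (use J_relations(2)[of c x p] in \<open>simp add: algebra_simps\<close>)
      then show ?case ..
    qed
  qed (use B_one in \<open>auto intro: filt_J[OF J_zero] filt_B filt_scale add\<close>)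
qed

definition twisted :: "sv_index \<Rightarrow> free_sv \<Rightarrow> free_sv" where
  "twisted k p = gen k * p - fscale (\<psi> k) p"

text \<open>With \<open>x\<^sub>a\<close> for a creation generator and \<open>\<partial>\<^sub>a\<close> for its normalised twisted dual, the Euler operator is
\<open>\<Sum>\<^sub>a wt(a) x\<^sub>a \<partial>\<^sub>a\<close>. The sum over all \<open>a\<close> is infinite; only letters of weight at most \<open>S\<close> occur in
words of weight at most \<open>S\<close>, so the truncation loses nothing there.\<close>

definition euler_coeff :: "sv_index \<Rightarrow> complex" where
  "euler_coeff a = of_int (wt a) / (br_coeff (dual a) a * \<psi> (M 1))"

definition euler :: "int \<Rightarrow> free_sv \<Rightarrow> free_sv" where
  "euler S p = (\<Sum>a\<in>{a. creation a \<and> wt a \<le> S}. fscale (euler_coeff a) (gen a * twisted (dual a) p))"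

lemma euler_add: "euler S (p + q) = euler S p + euler S q"
  by (simp add: euler_def twisted_def algebra_simps fvs.scale_right_distrib sum.distrib fvs.scale_right_diff_distrib sum_subtractf)

lemma euler_J:
  assumes "\<And>a. creation a \<Longrightarrow> twisted (dual a) p \<in> J"
  shows "euler S p \<in> J"
  unfolding euler_def by (rule J_sum) (use assms in \<open>auto intro!: J_scale J_mult\<close>)

lemma twisted_J: "p \<in> J \<Longrightarrow> twisted k p \<in> J"
  by (auto simp: twisted_def intro!: J_diff J_mult J_scale)

text \<open>The Leibniz rule for one summand \<open>x\<^sub>a \<partial>\<^sub>a\<close>: up to lower weight, it commutes with multiplication by the
letter \<open>b\<close>, apart from the term \<open>\<partial>\<^sub>a x\<^sub>b\<close>, which contributes \<open>wt(b) x\<^sub>b\<close> for \<open>a = b\<close> and nothing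
otherwise, since only then the bracket of the dual of \<open>a\<close> with \<open>b\<close> involves \<open>M\<^sub>1\<close>.\<close>

lemma euler_summand:
  assumes p: "filt s p" and a: "creation a" and b: "creation b"
  shows "filt (s + wt b - 1) (fscale (euler_coeff a) (gen a * twisted (dual a) (gen b * p))
      - fscale (euler_coeff a) (gen b * (gen a * twisted (dual a) p))
      - (if a = b then fscale (of_int (wt b)) (gen b * p) else 0))"
proof -
  let ?d = "dual a" and ?c = "euler_coeff a"
  define q where "q = twisted ?d p"
  have q: "filt (s - wt a) q"
    using filt_twisted[OF p positive_dual[OF a]] by (simp add: q_def twisted_def wt_dual)
  define R1 where "R1 = gen ?d * (gen b * p) - gen b * (gen ?d * p) - fscale (br_coeff ?d b) (gen (br_index ?d b) * p)"
  define R2 where "R2 = gen a * (gen b * q) - gen b * (gen a * q) - fscale (br_coeff a b) (gen (br_index a b) * q)"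
  have R: "R1 \<in> J" "R2 \<in> J"
    unfolding R1_def R2_def by (rule commute_mod_J)+
  have eq: "gen a * twisted ?d (gen b * p) - gen b * (gen a * q)
      = fscale (br_coeff ?d b) (gen a * (gen (br_index ?d b) * p))
        + fscale (br_coeff a b) (gen (br_index a b) * q) + (gen a * R1 + R2)"
    by (simp add: R1_def R2_def q_def twisted_def algebra_simps)
  have R3: "gen a * R1 + R2 \<in> J"
    using R by (auto intro: J_add J_mult)
  \<comment> \<open>Exchanging two creation generators loses weight; the result is not \<open>M\<^sub>1\<close> by its weight.\<close>
  have t2: "filt (s + wt b - 1) (fscale (br_coeff a b) (gen (br_index a b) * q))"
  proof (cases "br_coeff a b = 0")
    case False
    then have wt: "wt (br_index a b) = wt a + wt b - 3"
      by (rule wt_br_index)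
    then have "br_index a b \<noteq> M 1"
      using creation_wt_pos[OF a] creation_wt_pos[OF b] by auto
    then show ?thesis
      using filt_mono[OF filt_act[OF q]] wt by (intro filt_scale) simp
  qed (simp add: filt_J)
  \<comment> \<open>The bracket of the dual with \<open>b\<close> gives the leading term through \<open>M\<^sub>1\<close>.\<close>
  have t1: "filt (s + wt b - 1) (fscale ?c (fscale (br_coeff ?d b) (gen a * (gen (br_index ?d b) * p)))
      - (if a = b then fscale (of_int (wt b)) (gen b * p) else 0))"
  proof (cases "a = b")
    case True
    have c: "?c * br_coeff ?d b * \<psi> (M 1) = of_int (wt b)"
      using br_coeff_dual[OF b] psi_M1 True by (simp add: euler_coeff_def)
    have "filt (s + wt b - 1) (gen b * (gen (M 1) * p - fscale (\<psi> (M 1)) p))"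
      by (rule filt.filt_mult[OF filt_M1[OF p] b]) simp
    then have "filt (s + wt b - 1)
        (fscale (?c * br_coeff ?d b) (gen b * (gen (M 1) * p - fscale (\<psi> (M 1)) p)))"
      by (rule filt_scale)
    then show ?thesis
      using True br_index_dual[of b] c by (simp add: algebra_simps fvs.scale_right_diff_distrib)
  next
    case False
    show ?thesis
    proof (cases "br_coeff ?d b = 0")
      case nz: False
      then have wt: "wt (br_index ?d b) = wt b - wt a - 3"
        using wt_br_index[OF nz] by (simp add: wt_dual)
      have "br_index ?d b \<noteq> M 1"
        using br_index_dual_M1[OF nz] False by blast
      from filt_mult[OF filt_act[OF p this] a order_refl]
      have "filt (s + wt b - 1) (gen a * (gen (br_index ?d b) * p))"
        using wt by (simp add: algebra_simps)
      then show ?thesis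
        using False by (simp add: filt_scale del: fvs.scale_scale)
    qed (use False in \<open>simp add: filt_J\<close>)
  qed
  have "filt (s + wt b - 1) (fscale ?c (fscale (br_coeff ?d b) (gen a * (gen (br_index ?d b) * p)))
      - (if a = b then fscale (of_int (wt b)) (gen b * p) else 0)
      + fscale ?c (fscale (br_coeff a b) (gen (br_index a b) * q) + (gen a * R1 + R2)))"
    by (intro filt_add[OF t1] filt_scale filt_add[OF t2] filt_J R3)
  moreover have "fscale ?c (gen a * twisted ?d (gen b * p)) - fscale ?c (gen b * (gen a * q))
      = fscale ?c (fscale (br_coeff ?d b) (gen a * (gen (br_index ?d b) * p)))
      + fscale ?c (fscale (br_coeff a b) (gen (br_index a b) * q) + (gen a * R1 + R2))"
    by (simp only: eq add.assoc flip: fvs.scale_right_diff_distrib fvs.scale_right_distrib)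
  ultimately show ?thesis
    by (simp add: q_def algebra_simps)
qed

text \<open>The Euler operator acts on the associated graded space in weight \<open>s\<close> as multiplication by \<open>s\<close>, by
induction on words and the Leibniz rule.\<close>

lemma euler_filt:
  assumes "filt s p" "s \<le> S"
  shows "filt (s - 1) (euler S p - fscale (of_int s) p)"
  using assms
proof (induction rule: filt.induct)
  case (filt_J p s)
  then show ?case
    by (auto intro!: filt.filt_J J_diff J_scale euler_J twisted_J)
next
  case (filt_B p s)
  have "euler S p \<in> J"
    by (rule euler_J) (use filt_B B_whittaker positive_dual in \<open>auto simp: twisted_def\<close>)
  moreover have "filt (s - 1) (fscale (of_int s) p)"
    by (cases "s = 0") (use filt_B in \<open>auto intro!: filt.filt_B filt_scale filt.filt_J[OF J_zero]\<close>)
  ultimately show ?case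
    by (rule filt_diff[OF filt.filt_J])
next
  case (filt_add s p q)
  have "filt (s - 1) ((euler S p - fscale (of_int s) p) + (euler S q - fscale (of_int s) q))"
    using filt_add by (intro filt.filt_add) auto
  then show ?case
    by (simp add: euler_add fvs.scale_right_distrib algebra_simps)
next
  case (filt_mult s p b t)
  let ?A = "{a. creation a \<and> wt a \<le> S}" and ?u = "s + wt b"
  note b = filt_mult.hyps(2)
  \<comment> \<open>For \<open>s < 0\<close> the letter \<open>b\<close> may be missing in the truncated sum, but then \<open>p\<close> lies in \<open>J\<close>.\<close>
  have "p \<in> J \<or> s \<ge> 0"
    using filt_negative[OF filt_mult.hyps(1)] by linarith
  then show ?case
  proof
    assume "p \<in> J"
    then show ?thesis
      by (auto intro!: filt.filt_J J_diff J_scale euler_J twisted_J J_mult)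
  next
    assume "s \<ge> 0"
    then have bA: "b \<in> ?A"
      using filt_mult by auto
    have "filt (?u - 1) (\<Sum>a\<in>?A. fscale (euler_coeff a) (gen a * twisted (dual a) (gen b * p))
        - fscale (euler_coeff a) (gen b * (gen a * twisted (dual a) p))
        - (if a = b then fscale (of_int (wt b)) (gen b * p) else 0))"
      by (rule filt_sum, rule euler_summand[OF filt_mult.hyps(1)]) (use b in auto)
    then have "filt (?u - 1) (euler S (gen b * p) - gen b * euler S p - fscale (of_int (wt b)) (gen b * p))"
      using bA finite_creation[of S]
      by (simp add: euler_def sum_subtractf sum.delta' sum_distrib_left)
    moreover have "filt (?u - 1) (gen b * (euler S p - fscale (of_int s) p))"
      by (rule filt.filt_mult[OF filt_mult.IH b])
        (use filt_mult.prems filt_mult.hyps(3) creation_wt_pos[OF b] in auto)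
    ultimately have "filt (?u - 1) ((euler S (gen b * p) - gen b * euler S p
        - fscale (of_int (wt b)) (gen b * p)) + gen b * (euler S p - fscale (of_int s) p))"
      by (rule filt_add)
    then have exact: "filt (?u - 1) (euler S (gen b * p) - fscale (of_int ?u) (gen b * p))"
      by (simp add: algebra_simps fvs.scale_left_distrib)
    show ?thesis
    proof (cases "t = ?u")
      case False
      have "filt (t - 1) (fscale (of_int (t - ?u)) (gen b * p))"
        by (intro filt_scale filt.filt_mult[OF filt_mult.hyps(1) b]) (use False filt_mult.hyps(3) in simp)
      then have "filt (t - 1) ((euler S (gen b * p) - fscale (of_int ?u) (gen b * p))
          - fscale (of_int (t - ?u)) (gen b * p))"
        by (intro filt_diff filt_mono[OF exact]) (use filt_mult.hyps(3) in auto)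
      then show ?thesis
        by (simp add: algebra_simps fvs.scale_left_diff_distrib fvs.scale_left_distrib)
    qed (use exact in simp)
  qed
qed

text \<open>If all twisted duals kill \<open>p\<close> modulo \<open>J\<close>, so does the Euler operator. As it is \<open>s\<close> modulo lower weight,
\<open>p\<close> descends from weight \<open>s > 0\<close> to weight \<open>s - 1\<close>, and finally to \<open>B\<close>.\<close>

lemma whittaker_vector_in_base:
  assumes "filt s p" and ann: "\<And>a. creation a \<Longrightarrow> twisted (dual a) p \<in> J"
  shows "p \<in> B"
proof (cases "s \<ge> 0")
  case True
  then show ?thesis
    using assms(1)
  proof (induction s rule: int_ge_induct)
    case base
    then show ?case by (rule filt_zero) simp
  next
    case (step s)
    have "filt s (euler (s + 1) p - fscale (of_int (s + 1)) p)"
      using euler_filt[OF step.prems order_refl] by simp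
    moreover have "filt s (euler (s + 1) p)"
      by (intro filt_J euler_J ann)
    ultimately have "filt s (euler (s + 1) p - (euler (s + 1) p - fscale (of_int (s + 1)) p))"
      by (rule filt_diff[rotated])
    moreover have "x - (x - y) = y" for x y :: free_sv
      by simp
    ultimately have "filt s (fscale (of_int (s + 1)) p)"
      by (simp only:)
    then have "filt s (fscale (inverse (of_int (s + 1))) (fscale (of_int (s + 1)) p))"
      by (rule filt_scale)
    moreover have "of_int (s + 1) \<noteq> (0 :: complex)"
      using step.hyps by (simp only: of_int_eq_0_iff)
    ultimately show ?case
      using step.IH by simp
  qed
next
  case False
  then show ?thesis
    using filt_negative[OF assms(1)] B_sub by auto
qed

end


section \<open>Simplicity of the quotient and the central character\<close>

lemma central_M0: "p * gen (M 0) - gen (M 0) * p \<in> I_sv"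
proof (induction p rule: free_alg_induct)
  case (letter x p)
  have br: "sv_bracket x (basis_vec (M 0)) = 0"
  proof (induction x rule: fvs_induct)
    case (basis a)
    then show ?case by (cases a) (simp_all add: sv_bracket_linear)
  qed (simp_all add: sv_bracket_linear)
  have "letter (0 :: sv) \<in> I_sv"
    using I_sv_relations(2)[of 0 0] by simp
  then have "letter x * gen (M 0) - gen (M 0) * letter x \<in> I_sv"
    using I_sv_add[OF I_sv_relations(3)[of x "basis_vec (M 0)"]] br by fastforce
  from I_sv_add[OF I_sv_mult_left[OF letter, of "letter x"] I_sv_mult_right[OF this, of p]]
  show ?case
    by (simp add: algebra_simps)
next
  case (add p q)
  then show ?case
    using I_sv_add[OF add] by (simp add: algebra_simps)
next
  case (scale c p)
  then show ?case
    using I_sv_mult_left[OF scale, of "fscale c 1"] by (simp add: fvs.scale_right_diff_distrib)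
qed simp_all

context whittaker_left_ideal
begin

text \<open>Once \<open>M\<^sub>0\<close> acts by a scalar, the module \<open>F/J\<close> over the free algebra \<open>F\<close> is simple. A vector of
minimal weight in a submodule \<open>N/J\<close> is killed by all twisted duals, as these lower the weight;
hence it is a scalar multiple of the generator, and the scalar is zero if \<open>N\<close> is proper.\<close>

lemma simple_quotient:
  assumes xi: "gen (M 0) - fscale \<xi> 1 \<in> J"
    and N: "left_ideal_sv N" "J \<subseteq> N" "1 \<notin> N"
  shows "N \<subseteq> J"
proof -
  interpret N: left_ideal_sv N by fact
  define B where "B = {fscale c 1 + j | c j. j \<in> J}"
  have BI: "q \<in> B" if "q - fscale c 1 \<in> J" for q c
    unfolding B_def using that by (auto intro!: exI[of _ c] exI[of _ "q - fscale c 1"])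
  interpret whittaker_base J \<psi> B
  proof unfold_locales
    show "1 \<in> B"
      using BI[of 1 1] by simp
    show "J \<subseteq> B"
      using BI[of _ 0] by auto
    show "p + q \<in> B" if pq: "p \<in> B" "q \<in> B" for p q
    proof -
      obtain c i d j where "p = fscale c 1 + i" "q = fscale d 1 + j" "i \<in> J" "j \<in> J"
        using pq unfolding B_def by blast
      then show ?thesis
        using J_add[of i j] by (intro BI[of _ "c + d"]) (simp add: fvs.scale_left_distrib)
    qed
    fix p assume "p \<in> B"
    then obtain c j where p: "p = fscale c 1 + j" "j \<in> J"
      unfolding B_def by blast
    show "fscale d p \<in> B" for d
      using p J_scale by (intro BI[of _ "d * c"]) (simp add: fvs.scale_right_distrib)
    show "gen (M 0) * p \<in> B"
      using p J_add[OF J_scale[OF xi, of c] J_mult[of j "gen (M 0)"]]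
      by (intro BI[of _ "c * \<xi>"]) (simp add: algebra_simps fvs.scale_right_diff_distrib)
    show "gen k * p - fscale (\<psi> k) p \<in> J" if "positive k" for k
      using p J_add[OF J_scale[OF J_whittaker[OF that], of c] J_mult[of j "gen k - fscale (\<psi> k) 1"]]
      by (simp add: algebra_simps fvs.scale_right_diff_distrib)
  qed
  have "p \<in> J" if "filt s p" "p \<in> N" for s p
    using that
  proof (induction "nat (s + 1)" arbitrary: s p rule: less_induct)
    case less
    show ?case
    proof (cases "s < 0")
      case False
      have "twisted (dual a) p \<in> J" if a: "creation a" for a
      proof (rule less.hyps)
        show "filt (s + wt (dual a)) (twisted (dual a) p)"
          unfolding twisted_def by (rule filt_twisted[OF less.prems(1) positive_dual[OF a]])
        show "nat (s + wt (dual a) + 1) < nat (s + 1)"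
          using creation_wt_pos[OF a] False by (simp add: wt_dual)
        show "twisted (dual a) p \<in> N"
          unfolding twisted_def by (intro N.J_diff N.J_mult N.J_scale less.prems)
      qed
      then have "p \<in> B"
        by (rule whittaker_vector_in_base[OF less.prems(1)])
      then obtain c j where p: "p = fscale c 1 + j" "j \<in> J"
        unfolding B_def by blast
      then have "fscale c 1 \<in> N"
        using N.J_diff[of p j] less.prems(2) N(2) by auto
      then have "c = 0"
        using N.J_scale_iff[of c 1] N(3) by auto
      then show ?thesis
        using p by simp
    qed (use filt_negative less.prems in blast)
  qed
  then show ?thesis
    using filt_exhaustive by blast
qed

end

text \<open>The value of \<open>g\<close> at \<open>M\<^sub>0\<close>. Its coefficients are complex numbers, its argument lies in the
noncommutative free algebra.\<close>

definition M0_poly :: "complex poly \<Rightarrow> free_sv" where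
  "M0_poly g = fold_coeffs (\<lambda>a p. fscale a 1 + gen (M 0) * p) g 0"

lemma M0_poly_0 [simp]: "M0_poly 0 = 0"
  by (simp add: M0_poly_def)

lemma M0_poly_pCons [simp]: "M0_poly (pCons a g) = fscale a 1 + gen (M 0) * M0_poly g"
  by (cases "g = 0"; cases "a = 0") (simp_all add: M0_poly_def)

lemma M0_poly_add: "M0_poly (g + h) = M0_poly g + M0_poly h"
  by (induction g h rule: poly_induct2) (simp_all add: fvs.scale_left_distrib algebra_simps)

lemma M0_poly_smult: "M0_poly (smult c g) = fscale c (M0_poly g)"
  by (induction g) (simp_all add: fvs.scale_right_distrib)

lemma M0_poly_commute: "M0_poly g * gen (M 0) = gen (M 0) * M0_poly g"
  by (induction g) (simp_all add: algebra_simps mult.assoc)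

lemma M0_poly_linear_factor:
  "M0_poly ([:- \<xi>, 1:] * g) = M0_poly g * (gen (M 0) - fscale \<xi> 1)"
proof -
  have "[:- \<xi>, 1:] * g = pCons 0 g + smult (- \<xi>) g"
    by simp
  then show ?thesis
    by (simp only: M0_poly_add M0_poly_pCons M0_poly_smult) (simp add: M0_poly_commute algebra_simps)
qed

context whittaker_left_ideal
begin

text \<open>Schur's lemma for \<open>M\<^sub>0\<close> on the simple module \<open>F/J\<close>, without an appeal to dimension. Suppose that
\<open>M\<^sub>0\<close> does not act as zero. Then it is bijective, so \<open>u M\<^sub>0 = 1\<close> modulo \<open>J\<close> for some \<open>u\<close>. With \<open>1\<close> also
\<open>u\<close> is a Whittaker vector, hence \<open>u = g(M\<^sub>0)\<close> modulo \<open>J\<close> for a polynomial \<open>g\<close>. So \<open>M\<^sub>0\<close> is a root of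
the nonzero polynomial \<open>X g(X) - 1\<close>. This polynomial splits over \<open>\<complex>\<close>, and some linear factor
\<open>M\<^sub>0 - \<xi>\<close> is not injective, therefore zero.\<close>

lemma central_character:
  assumes one: "1 \<notin> J"
    and maximal: "\<And>N. \<lbrakk>left_ideal_sv N; J \<subseteq> N\<rbrakk> \<Longrightarrow> N = J \<or> N = UNIV"
  shows "\<exists>\<xi>. gen (M 0) - fscale \<xi> 1 \<in> J"
proof -
  let ?T = "gen (M 0)"
  have right: "p * (?T - fscale \<xi> 1) \<in> J" if "p \<in> J" for p \<xi>
  proof -
    have "(p * ?T - ?T * p) + ?T * p - fscale \<xi> p \<in> J"
      by (rule J_diff[OF J_add[OF subsetD[OF ideal_sub central_M0] J_mult[OF that]] J_scale[OF that]])
    then show ?thesis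
      by (simp add: algebra_simps)
  qed
  have cancel: "p \<in> J" if p: "p * (?T - fscale \<xi> 1) \<in> J" and nz: "?T - fscale \<xi> 1 \<notin> J" for p \<xi>
  proof -
    \<comment> \<open>Right multiplication by \<open>M\<^sub>0 - \<xi>\<close> descends to \<open>F/J\<close>; its kernel is zero or everything.\<close>
    let ?N = "{p. p * (?T - fscale \<xi> 1) \<in> J}"
    have "left_ideal_sv ?N"
      by unfold_locales
        (use ideal_sub I_sv_mult_right J_mult in \<open>auto simp: mult.assoc distrib_right intro: J_add\<close>)
    then have "?N = J \<or> ?N = UNIV"
      by (rule maximal) (use right in blast)
    moreover have "1 \<notin> ?N"
      using nz by simp
    ultimately show ?thesis
      using p by blast
  qed
  have root: "\<exists>\<xi>. ?T - fscale \<xi> 1 \<in> J" if "h \<noteq> 0" "M0_poly h \<in> J" for h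
    using that
  proof (induction "degree h" arbitrary: h rule: less_induct)
    case less
    show ?case
    proof (cases "degree h = 0")
      case True
      then obtain c where h: "h = [:c:]"
        using degree_eq_zeroE by blast
      then have "fscale c 1 \<in> J" "c \<noteq> 0"
        using less.prems by auto
      then have False
        using one J_scale_iff by blast
      then show ?thesis ..
    next
      case False
      then obtain \<xi> where "poly h \<xi> = 0"
        using alg_closed_imp_poly_has_root[of h] by auto
      then obtain g where g: "h = [:- \<xi>, 1:] * g"
        unfolding poly_eq_0_iff_dvd by (elim dvdE)
      have gnz: "g \<noteq> 0"
        using less.prems g by auto
      then have "degree g < degree h"
        using g by (simp add: degree_mult_eq del: mult_pCons_left)
      moreover have "M0_poly g \<in> J \<or> ?T - fscale \<xi> 1 \<in> J"
        using cancel less.prems(2) unfolding g M0_poly_linear_factor by blast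
      ultimately show ?thesis
        using less.hyps gnz by blast
    qed
  qed
  show ?thesis
  proof (cases "?T \<in> J")
    case True
    then show ?thesis
      by (intro exI[of _ 0]) simp
  next
    case False
    have cancel_T: "p \<in> J" if "p * ?T \<in> J" for p
      using cancel[of p 0] that False by simp
    have right_T: "p * ?T \<in> J" if "p \<in> J" for p
      using right[OF that, of 0] by simp
    \<comment> \<open>The preimage of the image of \<open>M\<^sub>0\<close>.\<close>
    let ?N = "{q. \<exists>u. q - u * ?T \<in> J}"
    have "left_ideal_sv ?N"
    proof unfold_locales
      show "I_sv \<subseteq> ?N"
        using ideal_sub by (auto intro!: exI[of _ 0])
      fix p assume "p \<in> ?N"
      then obtain u where u: "p - u * ?T \<in> J" by blast
      show "q * p \<in> ?N" for q
        using J_mult[OF u, of q] by (auto intro!: exI[of _ "q * u"] simp: algebra_simps)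
      fix q assume "q \<in> ?N"
      then obtain v where v: "q - v * ?T \<in> J" by blast
      show "p + q \<in> ?N"
        using J_add[OF u v] by (auto intro!: exI[of _ "u + v"] simp: algebra_simps)
    qed
    then have "?N = J \<or> ?N = UNIV"
      by (rule maximal) (auto intro!: exI[of _ 0])
    moreover have "?T \<in> ?N"
      by (auto intro!: exI[of _ 1])
    ultimately obtain u where u: "1 - u * ?T \<in> J"
      using False by blast
    have tw: "gen k * u - fscale (\<psi> k) u \<in> J" if k: "positive k" for k
    proof (rule cancel_T)
      have "(gen k - fscale (\<psi> k) 1) - (gen k - fscale (\<psi> k) 1) * (1 - u * ?T) \<in> J"
        by (intro J_diff[OF J_whittaker[OF k]] J_mult u)
      then show "(gen k * u - fscale (\<psi> k) u) * ?T \<in> J"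
        by (simp add: algebra_simps)
    qed
    \<comment> \<open>Every element of \<open>\<complex>[M\<^sub>0] + J\<close> is a Whittaker vector because \<open>M\<^sub>0\<close> is central.\<close>
    define B where "B = {p. \<exists>g. p - M0_poly g \<in> J}"
    interpret whittaker_base J \<psi> B
    proof unfold_locales
      show "1 \<in> B"
        unfolding B_def by (auto intro!: exI[of _ 1] simp: one_pCons)
      show "J \<subseteq> B"
        unfolding B_def by (auto intro!: exI[of _ 0])
      fix p assume "p \<in> B"
      then obtain g where g: "p - M0_poly g \<in> J"
        unfolding B_def by blast
      show "fscale c p \<in> B" for c
        using J_scale[OF g, of c] unfolding B_def
        by (auto intro!: exI[of _ "smult c g"] simp: M0_poly_smult fvs.scale_right_diff_distrib)
      show "?T * p \<in> B"
        using J_mult[OF g, of ?T] unfolding B_def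
        by (auto intro!: exI[of _ "pCons 0 g"] simp: algebra_simps)
      show "p + q \<in> B" if q: "q \<in> B" for q
      proof -
        obtain h where "q - M0_poly h \<in> J"
          using q unfolding B_def by blast
        from J_add[OF g this] show ?thesis
          unfolding B_def
          by (auto intro!: exI[of _ "g + h"] simp: M0_poly_add algebra_simps)
      qed
      show "gen k * p - fscale (\<psi> k) p \<in> J" if k: "positive k" for k
      proof -
        have poly: "gen k * M0_poly g - fscale (\<psi> k) (M0_poly g) \<in> J" for g
        proof (induction g)
          case (pCons a g)
          have c: "gen k * ?T - ?T * gen k \<in> I_sv"
            using central_M0[of "gen k"] .
          have "fscale a (gen k - fscale (\<psi> k) 1) + (gen k * ?T - ?T * gen k) * M0_poly g
              + ?T * (gen k * M0_poly g - fscale (\<psi> k) (M0_poly g)) \<in> J"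
            by (rule J_add[OF J_add[OF J_scale[OF J_whittaker[OF k]]
                  subsetD[OF ideal_sub I_sv_mult_right[OF c]]] J_mult[OF pCons.IH]])
          then show ?case
            by (simp add: algebra_simps fvs.scale_right_distrib fvs.scale_right_diff_distrib)
        qed simp
        have "(gen k * M0_poly g - fscale (\<psi> k) (M0_poly g)) + (gen k - fscale (\<psi> k) 1) * (p - M0_poly g) \<in> J"
          by (intro J_add poly J_mult g)
        then show ?thesis
          by (simp add: algebra_simps)
      qed
    qed
    obtain s where "filt s u"
      using filt_exhaustive by blast
    then have "u \<in> B"
      by (rule whittaker_vector_in_base) (use tw positive_dual in \<open>simp add: twisted_def\<close>)
    then obtain g where g: "u - M0_poly g \<in> J"
      unfolding B_def by blast
    \<comment> \<open>The left side is \<open>M\<^sub>0 g(M\<^sub>0) - 1\<close>.\<close>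
    have "- (1 - u * ?T) - (u - M0_poly g) * ?T \<in> J"
      by (intro J_diff J_uminus u right_T g)
    moreover have "pCons (-1) g \<noteq> 0"
      by simp
    ultimately show ?thesis
      using root[of "pCons (-1) g"] by (simp add: algebra_simps M0_poly_commute)
  qed
qed

end

section \<open>Modules as representations of the free algebra\<close>

context lie_module
begin

abbreviation "free_carrier \<equiv> carrier (free_alg (carrier G))"

lemmas smult_zero_one [simp] = V.smult_l_null[simplified] V.smult_one[simplified]

lemma act_zero [simp]:
  assumes x: "x \<in> carrier G" shows "act V x \<zero>\<^bsub>V\<^esub> = \<zero>\<^bsub>V\<^esub>"
proof -
  have "act V x (0 \<odot>\<^bsub>V\<^esub> \<zero>\<^bsub>V\<^esub>) = 0 \<odot>\<^bsub>V\<^esub> act V x \<zero>\<^bsub>V\<^esub>"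
    by (rule act_smult_right[OF x V.zero_closed])
  then show ?thesis
    by (simp only: smult_zero_one V.zero_closed act_closed[OF x])
qed

lemma word_act_closed:
  "\<lbrakk>set xs \<subseteq> carrier G; v \<in> carrier V\<rbrakk> \<Longrightarrow> foldr (act V) xs v \<in> carrier V"
  by (induction xs) (auto intro: act_closed)

lemma free_act_superset:
  assumes "finite A" "Poly_Mapping.keys p \<subseteq> A" "A \<subseteq> {w. set (letters w) \<subseteq> carrier G}" "v \<in> carrier V"
  shows "free_act V p v = (\<Oplus>\<^bsub>V\<^esub>w\<in>A. Poly_Mapping.lookup p w \<odot>\<^bsub>V\<^esub> foldr (act V) (letters w) v)"
  unfolding free_act_def
  by (rule V.add.finprod_mono_neutral_cong_left)
    (use assms word_act_closed in \<open>auto simp: in_keys_iff\<close>)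

lemma free_act_closed:
  assumes "p \<in> free_carrier" "v \<in> carrier V" shows "free_act V p v \<in> carrier V"
  unfolding free_act_def
  by (rule V.finsum_closed) (use assms word_act_closed in \<open>auto simp: free_alg_def\<close>)

lemma free_act_add:
  assumes "p \<in> free_carrier" "q \<in> free_carrier" "v \<in> carrier V"
  shows "free_act V (p + q) v = free_act V p v \<oplus>\<^bsub>V\<^esub> free_act V q v"
proof -
  let ?A = "Poly_Mapping.keys p \<union> Poly_Mapping.keys q"
  have A: "?A \<subseteq> {w. set (letters w) \<subseteq> carrier G}" "finite ?A"
    using assms by (auto simp: free_alg_def)
  have "free_act V (p + q) v
      = (\<Oplus>\<^bsub>V\<^esub>w\<in>?A. Poly_Mapping.lookup (p + q) w \<odot>\<^bsub>V\<^esub> foldr (act V) (letters w) v)"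
    by (rule free_act_superset[OF A(2) Poly_Mapping.keys_add A(1) assms(3)])
  also have "\<dots> = (\<Oplus>\<^bsub>V\<^esub>w\<in>?A. Poly_Mapping.lookup p w \<odot>\<^bsub>V\<^esub> foldr (act V) (letters w) v
      \<oplus>\<^bsub>V\<^esub> Poly_Mapping.lookup q w \<odot>\<^bsub>V\<^esub> foldr (act V) (letters w) v)"
    by (rule V.finsum_cong')
      (use A assms(3) word_act_closed in \<open>auto simp: lookup_add intro!: V.smult_l_distr[simplified]\<close>)
  also have "\<dots> = free_act V p v \<oplus>\<^bsub>V\<^esub> free_act V q v"
    unfolding free_act_superset[OF A(2) Un_upper1 A(1) assms(3)]
      free_act_superset[OF A(2) Un_upper2 A(1) assms(3)]
    by (rule V.finsum_addf) (use A assms(3) word_act_closed in auto)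
  finally show ?thesis .
qed

lemma free_act_scale:
  assumes "p \<in> free_carrier" "v \<in> carrier V"
  shows "free_act V (fscale c p) v = c \<odot>\<^bsub>V\<^esub> free_act V p v"
proof -
  let ?A = "Poly_Mapping.keys p"
  have A: "?A \<subseteq> {w. set (letters w) \<subseteq> carrier G}" "finite ?A"
    using assms by (auto simp: free_alg_def)
  have "free_act V (fscale c p) v
      = (\<Oplus>\<^bsub>V\<^esub>w\<in>?A. Poly_Mapping.lookup (fscale c p) w \<odot>\<^bsub>V\<^esub> foldr (act V) (letters w) v)"
    by (rule free_act_superset[OF A(2) _ A(1) assms(2)]) (auto simp: in_keys_iff)
  also have "\<dots> = (\<Oplus>\<^bsub>V\<^esub>w\<in>?A. c \<odot>\<^bsub>V\<^esub> (Poly_Mapping.lookup p w \<odot>\<^bsub>V\<^esub> foldr (act V) (letters w) v))"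
    by (rule V.finsum_cong')
      (use A assms(2) word_act_closed in \<open>auto intro!: V.smult_assoc1[simplified]\<close>)
  also have "\<dots> = c \<odot>\<^bsub>V\<^esub> free_act V p v"
    unfolding free_act_def
    by (rule V.finsum_smult_ldistr[symmetric]) (use A assms(2) word_act_closed in auto)
  finally show ?thesis .
qed

lemma free_act_zero [simp]: "free_act V 0 v = \<zero>\<^bsub>V\<^esub>"
  by (simp add: free_act_def)

lemma free_act_word:
  assumes "set xs \<subseteq> carrier G" "v \<in> carrier V"
  shows "free_act V (basis_vec (Word xs)) v = foldr (act V) xs v"
  using word_act_closed[OF assms] by (simp add: free_act_def basis_vec_def)

lemma free_act_one [simp]: "v \<in> carrier V \<Longrightarrow> free_act V 1 v = v"
  using free_act_word[of "[]" v] by (simp add: basis_vec_word_Nil)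

lemma free_act_letter:
  assumes "x \<in> carrier G" "p \<in> free_carrier" "v \<in> carrier V"
  shows "free_act V (letter x * p) v = act V x (free_act V p v)"
  using assms(2) unfolding carrier_free_alg mem_Collect_eq
proof -
  let ?W = "{w. set (letters w) \<subseteq> carrier G}"
  assume "Poly_Mapping.keys p \<subseteq> ?W"
  then have "p \<in> free_carrier \<and> free_act V (letter x * p) v = act V x (free_act V p v)"
  proof (induction p rule: keys_induct)
    case (basis b)
    obtain xs where b: "b = Word xs"
      by (cases b)
    then show ?case
      using basis assms(1,3) free_act_word[of xs v] free_act_word[of "x # xs" v]
      by (simp add: basis_vec_word_Cons carrier_free_alg) (simp add: basis_vec_def)
  next
    case (add p q)
    then show ?case
      using assms
      by (simp add: free_act_add free_alg_closed distrib_left act_add_right free_act_closed)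
  next
    case (scale c p)
    then show ?case
      using assms
      by (simp add: free_act_scale free_alg_closed act_smult_right free_act_closed)
  qed (use assms in \<open>simp_all add: free_alg_closed\<close>)
  then show ?thesis ..
qed

lemma free_act_null: "p \<in> free_carrier \<Longrightarrow> free_act V p \<zero>\<^bsub>V\<^esub> = \<zero>\<^bsub>V\<^esub>"
  by (induction p rule: free_alg_carrier_induct)
    (simp_all add: free_act_letter free_act_add free_act_scale V.smult_r_null)

lemma free_act_letter_one:
  "\<lbrakk>x \<in> carrier G; v \<in> carrier V\<rbrakk> \<Longrightarrow> free_act V (letter x) v = act V x v"
  using free_act_letter[of x 1 v] by (simp add: free_alg_closed)

lemma free_act_mult:
  assumes "p \<in> free_carrier" "q \<in> free_carrier" "v \<in> carrier V"
  shows "free_act V (p * q) v = free_act V p (free_act V q v)"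
  using assms(1)
proof (induction p rule: free_alg_carrier_induct)
  case (letter x p)
  then show ?case
    using assms by (simp add: mult.assoc free_act_letter free_alg_closed free_act_closed)
next
  case (add p q)
  then show ?case
    using assms by (simp add: free_act_add free_alg_closed distrib_right free_act_closed)
next
  case (scale c p)
  then show ?case
    using assms by (simp add: free_act_scale free_alg_closed free_act_closed)
qed (use assms in \<open>simp_all add: free_act_closed\<close>)

lemma smult_minus_one:
  assumes v: "v \<in> carrier V" shows "(- 1) \<odot>\<^bsub>V\<^esub> v = \<ominus>\<^bsub>V\<^esub> v"
proof -
  have c: "(- 1) \<odot>\<^bsub>V\<^esub> v \<in> carrier V"
    by (rule V.smult_closed) (use v in auto)
  have "(- 1 + 1) \<odot>\<^bsub>V\<^esub> v = (- 1) \<odot>\<^bsub>V\<^esub> v \<oplus>\<^bsub>V\<^esub> 1 \<odot>\<^bsub>V\<^esub> v"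
    using V.smult_l_distr[of "- 1" 1 v] v by (simp only: complex_ring_simps UNIV_I)
  then have "(- 1) \<odot>\<^bsub>V\<^esub> v \<oplus>\<^bsub>V\<^esub> v = \<zero>\<^bsub>V\<^esub>"
    using v by simp
  then show ?thesis
    using V.minus_equality[OF _ v c] by simp
qed

lemma free_act_diff:
  assumes "p \<in> free_carrier" "q \<in> free_carrier" "v \<in> carrier V"
  shows "free_act V (p - q) v = free_act V p v \<ominus>\<^bsub>V\<^esub> free_act V q v"
proof -
  have "p - q = p + fscale (-1) q"
    by simp
  then have "free_act V (p - q) v = free_act V p v \<oplus>\<^bsub>V\<^esub> (-1) \<odot>\<^bsub>V\<^esub> free_act V q v"
    by (simp only: free_act_add[OF assms(1) free_alg_closed(2)[OF assms(2)] assms(3)]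
        free_act_scale[OF assms(2,3)])
  then show ?thesis
    by (simp only: smult_minus_one[OF free_act_closed[OF assms(2,3)]] V.minus_eq)
qed

text \<open>The elements of the free algebra that act as zero on a module form an ideal, and the module axioms
say that it contains the defining relations.\<close>

lemma uea_ideal_annihilates:
  assumes "p \<in> uea_ideal G" "v \<in> carrier V"
  shows "free_act V p v = \<zero>\<^bsub>V\<^esub>"
proof -
  define K where "K = {p \<in> free_carrier. \<forall>v\<in>carrier V. free_act V p v = \<zero>\<^bsub>V\<^esub>}"
  note diff = free_alg_diff_closed
  have "ideal K (free_alg (carrier G))"
    by (rule free_alg_idealI)
      (auto simp: K_def free_alg_closed free_act_add free_act_mult free_act_closed free_act_null)
  moreover have "uea_relations G \<subseteq> K"
  proof -
    have cancel: "a \<oplus>\<^bsub>V\<^esub> b \<ominus>\<^bsub>V\<^esub> a \<ominus>\<^bsub>V\<^esub> b = \<zero>\<^bsub>V\<^esub>" if "a \<in> carrier V" "b \<in> carrier V" for a b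
    proof -
      have "a \<oplus>\<^bsub>V\<^esub> b \<ominus>\<^bsub>V\<^esub> a = b"
        using that by (simp add: V.a_comm[of a b] V.minus_eq V.a_assoc V.r_neg)
      then show ?thesis
        using that by (simp add: V.minus_eq V.r_neg)
    qed
    have self: "a \<ominus>\<^bsub>V\<^esub> a = \<zero>\<^bsub>V\<^esub>" if "a \<in> carrier V" for a
      using that by (simp add: V.minus_eq V.r_neg)
    have "letter (x \<oplus>\<^bsub>G\<^esub> y) - letter x - letter y \<in> K" if "x \<in> carrier G" "y \<in> carrier G" for x y
      using that
      by (simp add: K_def diff free_alg_closed free_act_diff free_act_letter_one act_add_left
          act_closed cancel)
    moreover have "letter (c \<odot>\<^bsub>G\<^esub> x) - fscale c (letter x) \<in> K" if "x \<in> carrier G" for c x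
      using that
      by (simp add: K_def diff free_alg_closed free_act_diff free_act_letter_one free_act_scale
          act_smult_left act_closed self)
    moreover have "letter x * letter y - letter y * letter x - letter (bracket G x y) \<in> K"
      if "x \<in> carrier G" "y \<in> carrier G" for x y
      using that
      by (simp add: K_def diff free_alg_closed free_act_diff free_act_letter_one free_act_mult
          G.bracket_closed act_bracket act_closed self)
    ultimately show ?thesis
      by (auto simp: uea_relations_def)
  qed
  ultimately have "uea_ideal G \<subseteq> K"
    by (rule uea_ideal_minimal)
  then show ?thesis
    using assms by (auto simp: K_def)
qed

lemma uea_act_class:
  assumes "p \<in> free_carrier" "v \<in> carrier V"
  shows "uea_act V (uea_class G p) v = free_act V p v"
proof -
  interpret I: ideal "uea_ideal G" "free_alg (carrier G)"
    by (rule uea_ideal_ideal[OF G.lie_algebra_axioms])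
  have "(\<lambda>p. free_act V p v) ` uea_class G p = {free_act V p v}"
  proof -
    have "free_act V (i + p) v = free_act V p v" if "i \<in> uea_ideal G" for i
      using that I.Icarr[OF that] assms
      by (simp add: free_act_add uea_ideal_annihilates free_act_closed)
    moreover have "uea_ideal G \<noteq> {}"
      using additive_subgroup.zero_closed[OF I.is_additive_subgroup] by blast
    ultimately show ?thesis
      by (auto simp: uea_class_def a_r_coset_def' image_iff)
  qed
  then show ?thesis
    by (simp add: uea_act_def)
qed

end

section \<open>Presentations of cyclic modules\<close>

text \<open>A presentation exhibits a module as the quotient of the free algebra by a left ideal. It only asks
for compatibility with the operations of the target, which is cheaper to check for the quotients
of quotients below than the module axioms.\<close>

definition presents :: "(sv, 'v) lie_mod \<Rightarrow> (free_sv \<Rightarrow> 'v) \<Rightarrow> bool" where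
  "presents V \<theta> \<longleftrightarrow> abelian_group V \<and> range \<theta> = carrier V
    \<and> (\<forall>p q. \<theta> (p + q) = \<theta> p \<oplus>\<^bsub>V\<^esub> \<theta> q) \<and> (\<forall>c p. \<theta> (fscale c p) = c \<odot>\<^bsub>V\<^esub> \<theta> p)
    \<and> (\<forall>x p. \<theta> (letter x * p) = act V x (\<theta> p))"

definition annihilator :: "(sv, 'v) lie_mod \<Rightarrow> (free_sv \<Rightarrow> 'v) \<Rightarrow> free_sv set" where
  "annihilator V \<theta> = {p. \<theta> p = \<zero>\<^bsub>V\<^esub>}"

context
  fixes V :: "(sv, 'v) lie_mod" and \<theta>
  assumes presents: "presents V \<theta>"
begin

interpretation abelian_group V
  using presents by (simp add: presents_def)

lemma presents_closed: "\<theta> p \<in> carrier V"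
  using presents by (auto simp: presents_def)

lemma presents_add: "\<theta> (p + q) = \<theta> p \<oplus>\<^bsub>V\<^esub> \<theta> q"
  and presents_scale: "\<theta> (fscale c p) = c \<odot>\<^bsub>V\<^esub> \<theta> p"
  and presents_letter: "\<theta> (letter x * p) = act V x (\<theta> p)"
  using presents by (simp_all add: presents_def)

lemma presents_surj: "v \<in> carrier V \<Longrightarrow> \<exists>p. v = \<theta> p"
  using presents by (auto simp: presents_def)

lemma presents_zero: "\<theta> 0 = \<zero>\<^bsub>V\<^esub>"
  using presents_add[of 0 0] presents_closed[of 0] add.l_cancel_one' by simp

lemma presents_eq_iff: "\<theta> p = \<theta> q \<longleftrightarrow> p - q \<in> annihilator V \<theta>"
proof -
  have "\<theta> p = \<theta> (p - q) \<oplus>\<^bsub>V\<^esub> \<theta> q"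
    using presents_add[of "p - q" q] by simp
  then show ?thesis
    using presents_closed by (auto simp: annihilator_def)
qed

lemma presents_left_ideal:
  assumes "I_sv \<subseteq> annihilator V \<theta>"
  shows "left_ideal_sv (annihilator V \<theta>)"
proof
  show "p + q \<in> annihilator V \<theta>" if "p \<in> annihilator V \<theta>" "q \<in> annihilator V \<theta>" for p q
    using that by (simp add: annihilator_def presents_add)
  show "q * p \<in> annihilator V \<theta>" if p: "p \<in> annihilator V \<theta>" for p q
  proof (induction q rule: free_alg_induct)
    case (letter x q)
    have "\<theta> (letter x * (q * p)) = \<theta> (letter x * 0)"
      unfolding presents_letter using letter by (simp add: annihilator_def presents_zero)
    then show ?case
      by (simp add: annihilator_def presents_zero mult.assoc)
  next
    case (add q r)
    then show ?case
      by (simp add: annihilator_def presents_add distrib_right)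
  next
    case (scale c q)
    have "\<theta> (fscale c (q * p)) = \<theta> (fscale c 0)"
      unfolding presents_scale using scale by (simp add: annihilator_def presents_zero)
    then show ?case
      by (simp add: annihilator_def presents_zero)
  qed (use p in \<open>simp_all add: annihilator_def presents_zero\<close>)
qed (rule assms)

end

text \<open>Both modules are the same quotient of the free algebra.\<close>

lemma isomorphic_if_annihilators_eq:
  fixes V :: "(sv, 'v) lie_mod" and W :: "(sv, 'w) lie_mod"
  assumes V: "presents V \<theta>" and W: "presents W \<eta>"
    and eq: "annihilator V \<theta> = annihilator W \<eta>"
  shows "lie_modules_isomorphic sv V W"
proof -
  have iff: "\<theta> p = \<theta> q \<longleftrightarrow> \<eta> p = \<eta> q" for p q
    by (simp add: presents_eq_iff[OF V] presents_eq_iff[OF W] eq)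
  define f where "f v = \<eta> (SOME p. \<theta> p = v)" for v
  have f: "f (\<theta> p) = \<eta> p" for p
  proof -
    have "\<theta> (SOME q. \<theta> q = \<theta> p) = \<theta> p"
      by (rule someI[of _ p]) simp
    then show ?thesis
      by (simp add: f_def iff)
  qed
  have "inj_on f (carrier V)"
  proof (rule inj_onI)
    fix u v assume uv: "u \<in> carrier V" "v \<in> carrier V" "f u = f v"
    then obtain p q where "u = \<theta> p" "v = \<theta> q"
      using presents_surj[OF V] by blast
    then show "u = v"
      using uv(3) by (simp add: f iff)
  qed
  moreover have "f ` carrier V = carrier W"
    using V W f by (auto simp: presents_def image_iff) (metis rangeI rangeE)+
  moreover have "f (u \<oplus>\<^bsub>V\<^esub> v) = f u \<oplus>\<^bsub>W\<^esub> f v" if uv: "u \<in> carrier V" "v \<in> carrier V" for u v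
  proof -
    obtain p q where "u = \<theta> p" "v = \<theta> q"
      using presents_surj[OF V] uv by blast
    then show ?thesis
      by (simp only: f presents_add[OF V, symmetric] presents_add[OF W, symmetric])
  qed
  moreover have "f (c \<odot>\<^bsub>V\<^esub> v) = c \<odot>\<^bsub>W\<^esub> f v" "f (act V x v) = act W x (f v)" if "v \<in> carrier V" for c v x
  proof -
    obtain p where "v = \<theta> p"
      using presents_surj[OF V] \<open>v \<in> carrier V\<close> by blast
    then show "f (c \<odot>\<^bsub>V\<^esub> v) = c \<odot>\<^bsub>W\<^esub> f v" "f (act V x v) = act W x (f v)"
      by (simp_all only: f presents_scale[OF V, symmetric] presents_scale[OF W, symmetric]
          presents_letter[OF V, symmetric] presents_letter[OF W, symmetric])
  qed
  ultimately show ?thesis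
    unfolding lie_modules_isomorphic_def lie_module_iso_def bij_betw_def
    by (intro exI[of _ f]) simp
qed


section \<open>Quotient modules\<close>

lemma abelian_subgroupI_closed:
  assumes "abelian_group V" "N \<subseteq> carrier V" "\<zero>\<^bsub>V\<^esub> \<in> N"
    and "\<And>x. x \<in> N \<Longrightarrow> \<ominus>\<^bsub>V\<^esub> x \<in> N" "\<And>x y. \<lbrakk>x \<in> N; y \<in> N\<rbrakk> \<Longrightarrow> x \<oplus>\<^bsub>V\<^esub> y \<in> N"
  shows "abelian_subgroup N V"
proof -
  interpret abelian_group V by fact
  have "subgroup N (add_monoid V)"
    by (rule add.subgroupI) (use assms in auto)
  then show ?thesis
    by (intro abelian_subgroupI3 additive_subgroupI assms)
qed

locale quotient_by = abelian_subgroup N V for N and V :: "('g, 'v) lie_mod" (structure)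
begin

abbreviation Q where "Q \<equiv> quot_mod V N"
abbreviation proj where "proj v \<equiv> N +>\<^bsub>V\<^esub> v"

lemma quot_carrier: "carrier Q = proj ` carrier V"
  by (auto simp: quot_mod_def A_RCOSETS_def')

lemma quot_add: "\<lbrakk>x \<in> carrier V; y \<in> carrier V\<rbrakk> \<Longrightarrow> proj x \<oplus>\<^bsub>Q\<^esub> proj y = proj (x \<oplus> y)"
  by (simp add: quot_mod_def a_rcos_sum)

lemma quot_zero: "\<zero>\<^bsub>Q\<^esub> = N"
  by (simp add: quot_mod_def)

lemma proj_eq_iff:
  assumes "x \<in> carrier V" "y \<in> carrier V"
  shows "proj x = proj y \<longleftrightarrow> x \<ominus> y \<in> N"
proof -
  have "x \<ominus> y \<in> N \<longleftrightarrow> x \<in> proj y"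
    using a_rcos_module[OF assms(2,1)] by (simp add: minus_eq)
  also have "\<dots> \<longleftrightarrow> proj x = proj y"
    using a_repr_independence[OF _ assms(2)] a_rcos_self[OF assms(1)] a_subgroup by blast
  finally show ?thesis ..
qed

lemma proj_zero: "proj \<zero> = \<zero>\<^bsub>Q\<^esub>"
  by (simp add: quot_zero a_subset)

lemma proj_eq_zero_iff: "x \<in> carrier V \<Longrightarrow> proj x = \<zero>\<^bsub>Q\<^esub> \<longleftrightarrow> x \<in> N"
  using proj_eq_iff[of x \<zero>] minus_equality[of \<zero> \<zero>] by (simp add: proj_zero minus_eq)

lemma quot_abelian_group: "abelian_group Q"
proof -
  interpret F: comm_group "V A_Mod N"
    by (rule a_factorgroup_is_comm_group)
  have F: "carrier Q = carrier (V A_Mod N)" "ring.add Q = monoid.mult (V A_Mod N)"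
    "\<zero>\<^bsub>Q\<^esub> = \<one>\<^bsub>V A_Mod N\<^esub>"
    by (simp_all add: quot_mod_def A_FactGroup_def' fun_eq_iff)
  show ?thesis
    by (rule abelian_groupI; unfold F)
      (rule F.m_closed F.one_closed F.m_assoc F.m_comm F.l_one F.l_inv_ex; assumption)+
qed

lemma quot_minus:
  assumes "x \<in> carrier V" "y \<in> carrier V"
  shows "proj x \<ominus>\<^bsub>Q\<^esub> proj y = proj (x \<ominus> y)"
proof -
  interpret Q: abelian_group Q by (rule quot_abelian_group)
  have "\<ominus>\<^bsub>Q\<^esub> proj y = proj (\<ominus> y)"
    by (rule Q.minus_equality) (use assms in \<open>auto simp: quot_add l_neg proj_zero quot_carrier\<close>)
  then show ?thesis
    using assms by (simp add: Q.minus_eq quot_add minus_eq)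
qed

text \<open>The operations of \<open>quot_mod\<close> are unions over a coset; for a linear map that preserves \<open>N\<close> the union
is a single coset.\<close>

lemma quot_lift:
  assumes g: "\<And>x. x \<in> carrier V \<Longrightarrow> g x \<in> carrier V"
    and add: "\<And>x y. \<lbrakk>x \<in> carrier V; y \<in> carrier V\<rbrakk> \<Longrightarrow> g (x \<oplus> y) = g x \<oplus> g y"
    and N: "\<And>x. x \<in> N \<Longrightarrow> g x \<in> N"
    and v: "v \<in> carrier V"
  shows "(\<Union>u\<in>proj v. proj (g u)) = proj (g v)"
proof -
  have "proj (g u) = proj (g v)" if u: "u \<in> proj v" for u
  proof -
    obtain n where n: "n \<in> N" "u = n \<oplus> v"
      using u by (auto simp: a_r_coset_def')
    then have "g u = g n \<oplus> g v"
      using v by (simp add: add)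
    then have "g u \<in> proj (g v)"
      using N[OF n(1)] by (auto simp: a_r_coset_def')
    then show ?thesis
      using a_repr_independence[OF _ g[OF v]] a_subgroup by blast
  qed
  moreover have "proj v \<noteq> {}"
    using a_rcos_self[OF v] by blast
  ultimately show ?thesis
    by blast
qed

end

section \<open>Classes in the enveloping algebras\<close>

abbreviation cls :: "free_sv \<Rightarrow> free_sv set" where "cls \<equiv> uea_class sv"


lemma uea_sv: "uea sv = free_alg UNIV Quot I_sv"
  by (simp add: uea_def)

lemma cls_eq_coset: "cls p = I_sv +>\<^bsub>free_alg UNIV\<^esub> p"
  by (simp add: uea_class_def)

lemma carrier_uea: "carrier (uea sv) = range cls"
  by (auto simp: uea_sv FactRing_def A_RCOSETS_def' cls_eq_coset)

lemma cls_add: "cls p \<oplus>\<^bsub>uea sv\<^esub> cls q = cls (p + q)"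
  and cls_mult: "cls p \<otimes>\<^bsub>uea sv\<^esub> cls q = cls (p * q)"
proof -
  interpret I: ideal I_sv "free_alg UNIV"
    using uea_ideal_ideal[OF lie_algebra_sv] by simp
  show "cls p \<oplus>\<^bsub>uea sv\<^esub> cls q = cls (p + q)"
    by (simp add: uea_sv FactRing_def cls_eq_coset I.a_rcos_sum)
  show "cls p \<otimes>\<^bsub>uea sv\<^esub> cls q = cls (p * q)"
    by (simp add: uea_sv FactRing_def cls_eq_coset I.rcoset_mult_add)
qed

lemma in_cls: "q \<in> cls p \<longleftrightarrow> q - p \<in> I_sv"
  by (auto simp: cls_eq_coset a_r_coset_def' intro!: bexI[of _ "q - p"])

lemma cls_eq_iff: "cls p = cls q \<longleftrightarrow> p - q \<in> I_sv"
proof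
  assume "cls p = cls q"
  then show "p - q \<in> I_sv"
    using in_cls[of p p] in_cls[of p q] by simp
next
  assume pq: "p - q \<in> I_sv"
  have "r - p \<in> I_sv \<longleftrightarrow> r - q \<in> I_sv" for r
    using I_sv_add[OF _ pq, of "r - p"] I_sv_add[OF _ I_sv_mult_left[OF pq, of "- 1"], of "r - q"]
    by auto
  then show "cls p = cls q"
    by (auto simp: in_cls)
qed

lemma sv_plus_simps [simp]: "ring.add sv_plus = (+)" "module.smult sv_plus = fscale"
  "bracket sv_plus = sv_bracket"
  by (simp_all add: sv_plus_def sv_def)

abbreviation "free_plus \<equiv> carrier (free_alg (carrier sv_plus))"

text \<open>This makes the map of enveloping algebras induced by the inclusion of \<open>sv\<^sup>+\<close> well defined.\<close>

lemma uea_ideal_sv_plus: "uea_ideal sv_plus \<subseteq> I_sv"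
proof -
  have "uea_ideal sv_plus \<subseteq> I_sv \<inter> free_plus"
  proof (rule uea_ideal_minimal)
    show "ideal (I_sv \<inter> free_plus) (free_alg (carrier sv_plus))"
      by (rule free_alg_idealI)
        (auto simp: free_alg_closed I_sv_add I_sv_mult_left I_sv_mult_right)
    have "uea_relations sv_plus \<subseteq> uea_relations sv"
      by (auto simp: uea_relations_def)
    then show "uea_relations sv_plus \<subseteq> I_sv \<inter> free_plus"
      using uea_relations_in_ideal[OF lie_algebra_sv] uea_relations_closed[OF lie_algebra_sv_plus] by blast
  qed
  then show ?thesis by blast
qed

lemma carrier_uea_plus: "carrier (uea sv_plus) = uea_class sv_plus ` free_plus"
  by (auto simp: uea_def FactRing_def A_RCOSETS_def' uea_class_def)

lemma uea_incl_class:
  assumes "q \<in> free_plus" shows "uea_incl sv_plus sv (uea_class sv_plus q) = cls q"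
proof -
  interpret P: ideal "uea_ideal sv_plus" "free_alg (carrier sv_plus)"
    by (rule uea_ideal_ideal[OF lie_algebra_sv_plus])
  have "cls (i + q) = cls q" if "i \<in> uea_ideal sv_plus" for i
    using that uea_ideal_sv_plus by (auto simp: cls_eq_iff)
  moreover have "uea_ideal sv_plus \<noteq> {}"
    using additive_subgroup.zero_closed[OF P.is_additive_subgroup] by blast
  ultimately have "cls ` uea_class sv_plus q = {cls q}"
    by (auto simp: uea_class_def a_r_coset_def' image_iff)
  then show ?thesis
    by (simp add: uea_incl_def)
qed


section \<open>The modules induced from one-dimensional modules\<close>

abbreviation tensor :: "free_sv \<Rightarrow> complex \<Rightarrow> (free_sv set \<times> complex \<Rightarrow>\<^sub>0 complex)" where
  "tensor p v \<equiv> pure (cls p) v"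

text \<open>The relations of the tensor product in terms of representatives in the free algebra, where all
computations take place.\<close>

lemma tensor_relations_eq:
  assumes hom: "lie_hom sv_plus complex_lie \<psi>"
  shows "tensor_relations sv sv_plus (one_dim_module \<psi>) =
     {tensor (p + q) v - tensor p v - tensor q v | p q v. True}
   \<union> {tensor p (v + w) - tensor p v - tensor p w | p v w. True}
   \<union> {tensor (fscale c p) v - fscale c (tensor p v) | c p v. True}
   \<union> {tensor p (c * v) - fscale c (tensor p v) | c p v. True}
   \<union> {tensor (p * q) v - tensor p (free_act (one_dim_module \<psi>) q v) | p q v. q \<in> free_plus}"
    (is "_ = ?A \<union> ?B \<union> ?C \<union> ?D \<union> ?E")
proof -
  interpret P: lie_module sv_plus "one_dim_module \<psi>"
    by (rule lie_module_one_dim[OF hom])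
  have V [simp]: "carrier (one_dim_module \<psi>) = UNIV" "ring.add (one_dim_module \<psi>) = (+)"
    "module.smult (one_dim_module \<psi>) = (*)"
    by (simp_all add: one_dim_module_def)
  have "{pure (u \<oplus>\<^bsub>uea sv\<^esub> u') v - pure u v - pure u' v | u u' v.
        u \<in> carrier (uea sv) \<and> u' \<in> carrier (uea sv) \<and> v \<in> carrier (one_dim_module \<psi>)} = ?A"
    unfolding carrier_uea V cls_add[symmetric] by blast
  moreover have "{pure u (v \<oplus>\<^bsub>one_dim_module \<psi>\<^esub> v') - pure u v - pure u v' | u v v'.
        u \<in> carrier (uea sv) \<and> v \<in> carrier (one_dim_module \<psi>) \<and> v' \<in> carrier (one_dim_module \<psi>)} = ?B"
    by (simp add: carrier_uea) blast
  moreover have "{pure (uea_class sv (fscale c 1) \<otimes>\<^bsub>uea sv\<^esub> u) v - fscale c (pure u v) | c u v.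
        u \<in> carrier (uea sv) \<and> v \<in> carrier (one_dim_module \<psi>)} = ?C"
  proof -
    have "tensor (fscale c p) v = pure (cls (fscale c 1) \<otimes>\<^bsub>uea sv\<^esub> cls p) v" for c p v
      by (simp add: cls_mult)
    then show ?thesis
      unfolding carrier_uea V by (simp only:) blast
  qed
  moreover have "{pure u (c \<odot>\<^bsub>one_dim_module \<psi>\<^esub> v) - fscale c (pure u v) | c u v.
        u \<in> carrier (uea sv) \<and> v \<in> carrier (one_dim_module \<psi>)} = ?D"
    by (simp add: carrier_uea) blast
  moreover have "{pure (u \<otimes>\<^bsub>uea sv\<^esub> uea_incl sv_plus sv r) v
        - pure u (uea_act (one_dim_module \<psi>) r v) | u r v.
        u \<in> carrier (uea sv) \<and> r \<in> carrier (uea sv_plus) \<and> v \<in> carrier (one_dim_module \<psi>)} = ?E"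
  proof -
    have eq: "pure (cls p \<otimes>\<^bsub>uea sv\<^esub> uea_incl sv_plus sv (uea_class sv_plus q)) v
        - pure (cls p) (uea_act (one_dim_module \<psi>) (uea_class sv_plus q) v)
        = tensor (p * q) v - tensor p (free_act (one_dim_module \<psi>) q v)" if "q \<in> free_plus" for p q v
      using that by (simp add: uea_incl_class cls_mult P.uea_act_class)
    have "{pure (u \<otimes>\<^bsub>uea sv\<^esub> uea_incl sv_plus sv r) v
        - pure u (uea_act (one_dim_module \<psi>) r v) | u r v.
        u \<in> carrier (uea sv) \<and> r \<in> carrier (uea sv_plus) \<and> v \<in> carrier (one_dim_module \<psi>)}
      = {pure (cls p \<otimes>\<^bsub>uea sv\<^esub> uea_incl sv_plus sv (uea_class sv_plus q)) v
        - pure (cls p) (uea_act (one_dim_module \<psi>) (uea_class sv_plus q) v) | p q v. q \<in> free_plus}"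
      unfolding carrier_uea carrier_uea_plus by (simp only: V) blast
    also have "\<dots> = ?E"
      by (rule Collect_cong, intro ex_cong1) (auto simp: eq)
    finally show ?thesis .
  qed
  ultimately show ?thesis
    unfolding tensor_relations_def by (simp only:)
qed

text \<open>Here \<open>T\<close> is the free space that the tensor product is a quotient of, \<open>R\<close> the span of the relations, and
\<open>L\<^bsub>\<psi>,\<xi>\<^esub>\<close> arises in two steps: \<open>W = T / R\<close> and then the quotient of \<open>W\<close> by \<open>Z = (M\<^sub>0 - \<xi>) W\<close>. The
computations are carried out in \<open>T\<close>, where elements can be compared without choosing cosets.\<close>

locale induced_whittaker =
  fixes \<psi> :: "sv \<Rightarrow> complex" and \<xi> :: complex
  assumes hom: "lie_hom sv_plus complex_lie \<psi>"
begin

abbreviation T where "T \<equiv> tensor_free sv (one_dim_module \<psi>)"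
abbreviation R where "R \<equiv> fspan (tensor_relations sv sv_plus (one_dim_module \<psi>))"
abbreviation W where "W \<equiv> universal_whittaker \<psi>"
abbreviation left_mult where "left_mult \<equiv> act T"

lemma relation_add: "tensor (p + q) v - tensor p v - tensor q v \<in> R"
  and relation_add_right: "tensor p (v + w) - tensor p v - tensor p w \<in> R"
  and relation_scale: "tensor (fscale c p) v - fscale c (tensor p v) \<in> R"
  and relation_scale_right: "tensor p (c * v) - fscale c (tensor p v) \<in> R"
  and relation_balanced:
    "q \<in> free_plus \<Longrightarrow> tensor (p * q) v - tensor p (free_act (one_dim_module \<psi>) q v) \<in> R"
proof -
  note rels = fvs.span_base[OF subsetD[OF equalityD2[OF tensor_relations_eq[OF hom]]]]
  show "tensor (p + q) v - tensor p v - tensor q v \<in> R"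
    by (rule rels, rule UnI1, rule UnI1, rule UnI1, rule UnI1, blast)
  show "tensor p (v + w) - tensor p v - tensor p w \<in> R"
    by (rule rels, rule UnI1, rule UnI1, rule UnI1, rule UnI2, blast)
  show "tensor (fscale c p) v - fscale c (tensor p v) \<in> R"
    by (rule rels, rule UnI1, rule UnI1, rule UnI2, blast)
  show "tensor p (c * v) - fscale c (tensor p v) \<in> R"
    by (rule rels, rule UnI1, rule UnI2, blast)
  show "tensor (p * q) v - tensor p (free_act (one_dim_module \<psi>) q v) \<in> R" if "q \<in> free_plus"
    by (rule rels, rule UnI2) (use that in blast)
qed

lemma R_induct [consumes 1, case_names zero add scale add_left add_right scale_left scale_right balanced]:
  assumes "t \<in> R"
    and "P 0" "\<And>s t. \<lbrakk>P s; P t\<rbrakk> \<Longrightarrow> P (s + t)" "\<And>c t. P t \<Longrightarrow> P (fscale c t)"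
    and "\<And>p q v. P (tensor (p + q) v - tensor p v - tensor q v)"
    and "\<And>p v w. P (tensor p (v + w) - tensor p v - tensor p w)"
    and "\<And>c p v. P (tensor (fscale c p) v - fscale c (tensor p v))"
    and "\<And>c p v. P (tensor p (c * v) - fscale c (tensor p v))"
    and "\<And>p q v. q \<in> free_plus \<Longrightarrow> P (tensor (p * q) v - tensor p (free_act (one_dim_module \<psi>) q v))"
  shows "P t"
  using assms(1)
proof (induction rule: fvs.span_induct_alt)
  case (step c a s)
  have "P a"
    using step(1) assms unfolding tensor_relations_eq[OF hom] by blast
  then show ?case
    using step assms by blast
qed (rule assms)

lemma carrier_T: "carrier T = {t. Poly_Mapping.keys t \<subseteq> range cls \<times> UNIV}"
  by (simp add: tensor_free_def carrier_uea one_dim_module_def)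

lemma T_ops [simp]: "ring.zero T = 0" "ring.add T = (+)" "module.smult T = fscale"
  by (simp_all add: tensor_free_def)

lemma subspace_T: "fvs.subspace (carrier T)"
  unfolding carrier_T by (rule subspace_keys)

lemma tensor_in_T: "tensor p v \<in> carrier T"
  by (simp add: carrier_T pure_def basis_vec_def)

lemma T_induct [consumes 1, case_names zero tensor add scale]:
  assumes "t \<in> carrier T" "P 0" "\<And>p v. P (tensor p v)"
    and "\<And>s t. \<lbrakk>s \<in> carrier T; t \<in> carrier T; P s; P t\<rbrakk> \<Longrightarrow> P (s + t)"
    and "\<And>c t. \<lbrakk>t \<in> carrier T; P t\<rbrakk> \<Longrightarrow> P (fscale c t)"
  shows "P t"
proof -
  have "Poly_Mapping.keys t \<subseteq> range cls \<times> UNIV"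
    using assms(1) by (simp add: carrier_T)
  then have "t \<in> carrier T \<and> P t"
  proof (induction t rule: keys_induct)
    case (basis b)
    then obtain p v where "b = (cls p, v)"
      by auto
    then show ?case
      using tensor_in_T[of p v] assms(3)[of p v] by (simp add: pure_def carrier_T)
  qed (use assms fvs.subspace_0[OF subspace_T] fvs.subspace_add[OF subspace_T]
      fvs.subspace_scale[OF subspace_T] in auto)
  then show ?thesis ..
qed

lemma left_mult_tensor [simp]: "left_mult x (tensor p v) = tensor (letter x * p) v"
  by (simp add: tensor_free_def pure_def cls_mult)

lemma left_mult_linear [simp]: "left_mult x (s + t) = left_mult x s + left_mult x t"
  "left_mult x (fscale c t) = fscale c (left_mult x t)" "left_mult x 0 = 0"
  "left_mult x (s - t) = left_mult x s - left_mult x t"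
proof -
  show add: "left_mult x (s + t) = left_mult x s + left_mult x t" for s t
    by (simp add: tensor_free_def lin_ext_add)
  show "left_mult x (fscale c t) = fscale c (left_mult x t)" "left_mult x 0 = 0"
    by (simp_all add: tensor_free_def lin_ext_scale)
  show "left_mult x (s - t) = left_mult x s - left_mult x t"
    using add[of "s - t" t] by simp
qed

lemma left_mult_closed: "t \<in> carrier T \<Longrightarrow> left_mult x t \<in> carrier T"
  by (induction t rule: T_induct)
    (auto simp: tensor_in_T fvs.subspace_0[OF subspace_T] fvs.subspace_add[OF subspace_T]
      fvs.subspace_scale[OF subspace_T])

lemma R_sub: "R \<subseteq> carrier T"
proof
  fix t assume "t \<in> R"
  then show "t \<in> carrier T"
    by (induction t rule: R_induct)
      (auto intro!: tensor_in_T fvs.subspace_0[OF subspace_T] fvs.subspace_add[OF subspace_T]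
        fvs.subspace_scale[OF subspace_T] fvs.subspace_diff[OF subspace_T])
qed

lemma left_mult_R: "t \<in> R \<Longrightarrow> left_mult x t \<in> R"
proof (induction t rule: R_induct)
  case (balanced p q v)
  then show ?case
    using relation_balanced[of q "letter x * p" v] by (simp add: mult.assoc)
qed (use relation_add[of "letter x * _" "letter x * _"] relation_add_right relation_scale[of _ "letter x * _"] relation_scale_right
      fvs.span_zero fvs.span_add fvs.span_scale in \<open>simp_all add: distrib_left\<close>)

text \<open>The image of \<open>M0_shift\<close> becomes the submodule \<open>(M\<^sub>0 - \<xi>) W\<^sub>\<psi>\<close> of the induced module.\<close>

definition M0_shift :: "(free_sv set \<times> complex \<Rightarrow>\<^sub>0 complex) \<Rightarrow> (free_sv set \<times> complex \<Rightarrow>\<^sub>0 complex)" where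
  "M0_shift t = left_mult (basis_vec (M 0)) t - fscale \<xi> t"

lemma M0_shift_linear: "M0_shift (s + t) = M0_shift s + M0_shift t" "M0_shift (fscale c t) = fscale c (M0_shift t)" "M0_shift 0 = 0"
  by (simp_all add: M0_shift_def fvs.scale_right_distrib fvs.scale_right_diff_distrib mult.commute)

lemma M0_shift_closed: "t \<in> carrier T \<Longrightarrow> M0_shift t \<in> carrier T"
  unfolding M0_shift_def
  by (intro fvs.subspace_diff[OF subspace_T] fvs.subspace_scale[OF subspace_T] left_mult_closed)

text \<open>The element \<open>M\<^sub>0\<close> is central in \<open>U(sv)\<close>, so the two left multiplications agree already on the free
space, before the tensor relations are imposed.\<close>

lemma left_mult_M0_shift: "t \<in> carrier T \<Longrightarrow> left_mult x (M0_shift t) = M0_shift (left_mult x t)"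
proof (induction t rule: T_induct)
  case (tensor p v)
  have "(letter x * gen (M 0) - gen (M 0) * letter x) * p \<in> I_sv"
    by (rule I_sv_mult_right[OF central_M0])
  then have "cls (letter x * (gen (M 0) * p)) = cls (gen (M 0) * (letter x * p))"
    by (simp add: cls_eq_iff left_diff_distrib mult.assoc)
  then show ?case
    by (simp add: M0_shift_def)
qed (simp_all add: M0_shift_linear)

lemma abelian_group_T: "abelian_group T"
proof -
  have "module complex_ring T"
    using module_fvs[OF subspace_T] by (simp add: tensor_free_def)
  then show ?thesis
    by (rule module.axioms)
qed

lemma T_minus: "s \<in> carrier T \<Longrightarrow> \<ominus>\<^bsub>T\<^esub> s = - s"
proof -
  assume s: "s \<in> carrier T"
  interpret abelian_group T by (rule abelian_group_T)
  show ?thesis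
    by (rule minus_equality) (use s fvs.subspace_neg[OF subspace_T s] in auto)
qed

lemma quotient_R: "quotient_by R T"
  unfolding quotient_by_def
proof (rule abelian_subgroupI_closed[OF abelian_group_T R_sub])
  show "\<ominus>\<^bsub>T\<^esub> t \<in> R" if "t \<in> R" for t
    using fvs.span_neg[OF that] T_minus[OF subsetD[OF R_sub that]] by simp
qed (auto intro: fvs.span_zero fvs.span_add)

lemma W_eq: "W = quot_mod T R"
  by (simp add: universal_whittaker_def induced_module_def)

sublocale R: quotient_by R T
  by (rule quotient_R)

lemma T_diff: "\<lbrakk>s \<in> carrier T; t \<in> carrier T\<rbrakk> \<Longrightarrow> s \<ominus>\<^bsub>T\<^esub> t = s - t"
  by (simp add: a_minus_def T_minus)

lemma W_act: "t \<in> carrier T \<Longrightarrow> act W x (R.proj t) = R.proj (left_mult x t)"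
  using R.quot_lift[of "left_mult x" t] left_mult_closed left_mult_R
  by (simp add: W_eq quot_mod_def)

lemma W_smult: "t \<in> carrier T \<Longrightarrow> c \<odot>\<^bsub>W\<^esub> R.proj t = R.proj (fscale c t)"
  using R.quot_lift[of "fscale c" t, OF _ _ fvs.span_scale] fvs.subspace_scale[OF subspace_T]
  by (simp add: W_eq quot_mod_def fvs.scale_right_distrib)

lemma W_add: "\<lbrakk>s \<in> carrier T; t \<in> carrier T\<rbrakk> \<Longrightarrow> R.proj s \<oplus>\<^bsub>W\<^esub> R.proj t = R.proj (s + t)"
  using R.quot_add by (simp add: W_eq)

lemma W_carrier: "carrier W = R.proj ` carrier T"
  using R.quot_carrier by (simp add: W_eq)

lemma W_eq_iff: "\<lbrakk>s \<in> carrier T; t \<in> carrier T\<rbrakk> \<Longrightarrow> R.proj s = R.proj t \<longleftrightarrow> s - t \<in> R"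
  using R.proj_eq_iff by (simp add: T_diff)

definition Z where
  "Z = {act W (basis_vec (M 0)) w \<ominus>\<^bsub>W\<^esub> \<xi> \<odot>\<^bsub>W\<^esub> w | w. w \<in> carrier W}"

lemma Z_eq: "Z = (\<lambda>t. R.proj (M0_shift t)) ` carrier T"
proof -
  have "act W (basis_vec (M 0)) (R.proj t) \<ominus>\<^bsub>W\<^esub> \<xi> \<odot>\<^bsub>W\<^esub> R.proj t = R.proj (M0_shift t)"
    if t: "t \<in> carrier T" for t
    using R.quot_minus[of "left_mult (basis_vec (M 0)) t" "fscale \<xi> t"] left_mult_closed[OF t]
      fvs.subspace_scale[OF subspace_T t]
    by (simp add: W_act W_smult t T_diff M0_shift_def flip: W_eq)
  then show ?thesis
    unfolding Z_def W_carrier by (auto simp: image_iff)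
qed

lemma abelian_group_W: "abelian_group W"
  using R.quot_abelian_group by (simp add: W_eq)

lemma quotient_Z: "quotient_by Z W"
  unfolding quotient_by_def
proof (rule abelian_subgroupI_closed[OF abelian_group_W])
  interpret W: abelian_group W by (rule abelian_group_W)
  have zeroW: "\<zero>\<^bsub>W\<^esub> = R.proj 0"
    using R.proj_zero by (simp add: W_eq)
  show "Z \<subseteq> carrier W"
    unfolding Z_eq W_carrier using M0_shift_closed by blast
  show "\<zero>\<^bsub>W\<^esub> \<in> Z"
    unfolding Z_eq zeroW using M0_shift_linear(3) fvs.subspace_0[OF subspace_T] by force
  fix x assume "x \<in> Z"
  then obtain s where s: "x = R.proj (M0_shift s)" "s \<in> carrier T"
    unfolding Z_eq by blast
  have neg: "- s \<in> carrier T"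
    by (rule fvs.subspace_neg[OF subspace_T s(2)])
  have "M0_shift (- s) + M0_shift s = 0"
    using M0_shift_linear(1)[of "- s" s] by (simp add: M0_shift_linear(3))
  then have "R.proj (M0_shift (- s)) \<oplus>\<^bsub>W\<^esub> x = \<zero>\<^bsub>W\<^esub>"
    by (simp add: s W_add M0_shift_closed neg zeroW)
  then have "\<ominus>\<^bsub>W\<^esub> x = R.proj (M0_shift (- s))"
    by (rule W.minus_equality) (use s neg M0_shift_closed W_carrier in auto)
  then show "\<ominus>\<^bsub>W\<^esub> x \<in> Z"
    unfolding Z_eq by (rule image_eqI[OF _ neg])
  fix y assume "y \<in> Z"
  then obtain t where t: "y = R.proj (M0_shift t)" "t \<in> carrier T"
    unfolding Z_eq by blast
  have "x \<oplus>\<^bsub>W\<^esub> y = R.proj (M0_shift (s + t))"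
    by (simp add: s t W_add M0_shift_closed M0_shift_linear)
  then show "x \<oplus>\<^bsub>W\<^esub> y \<in> Z"
    unfolding Z_eq by (rule image_eqI[OF _ fvs.subspace_add[OF subspace_T s(2) t(2)]])
qed

sublocale Z: quotient_by Z W
  by (rule quotient_Z)

lemma whittaker_quotient_eq: "whittaker_quotient \<psi> \<xi> = quot_mod W Z"
  unfolding whittaker_quotient_def Z_def Let_def by (rule refl)

text \<open>The map \<open>p \<mapsto> p \<cdot> (1 \<otimes> 1)\<close> to \<open>L\<^bsub>\<psi>,\<xi>\<^esub>\<close>.\<close>

definition present :: "free_sv \<Rightarrow> whittaker_carrier set" where
  "present p = Z.proj (R.proj (tensor p 1))"

lemma tensor_W: "R.proj (tensor p v) \<in> carrier W"
  using W_carrier tensor_in_T by blast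

lemma T_reduces_to_tensor: "t \<in> carrier T \<Longrightarrow> \<exists>p. t - tensor p 1 \<in> R"
proof (induction t rule: T_induct)
  case zero
  have "0 - tensor 0 1 \<in> R"
    using fvs.span_neg[OF relation_scale[of 0 0 1]] by simp
  then show ?case ..
next
  case (tensor p v)
  have "(tensor p (v * 1) - fscale v (tensor p 1)) - (tensor (fscale v p) 1 - fscale v (tensor p 1)) \<in> R"
    by (rule fvs.span_diff[OF relation_scale_right relation_scale])
  then show ?case
    by auto
next
  case (add s t)
  then obtain p q where "s - tensor p 1 \<in> R" "t - tensor q 1 \<in> R"
    by blast
  then have "(s - tensor p 1) + (t - tensor q 1) - (tensor (p + q) 1 - tensor p 1 - tensor q 1) \<in> R"
    by (rule fvs.span_diff[OF fvs.span_add relation_add])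
  then show ?case
    by (auto simp: algebra_simps intro!: exI[of _ "p + q"])
next
  case (scale c t)
  then obtain p where "t - tensor p 1 \<in> R"
    by blast
  then have "fscale c (t - tensor p 1) - (tensor (fscale c p) 1 - fscale c (tensor p 1)) \<in> R"
    by (rule fvs.span_diff[OF fvs.span_scale relation_scale])
  then show ?case
    by (auto simp: fvs.scale_right_diff_distrib intro!: exI[of _ "fscale c p"])
qed

lemma present_presents: "presents (whittaker_quotient \<psi> \<xi>) present"
  unfolding presents_def whittaker_quotient_eq
proof (intro conjI allI)
  show "abelian_group (quot_mod W Z)"
    by (rule Z.quot_abelian_group)
  show "range present = carrier (quot_mod W Z)"
  proof
    show "range present \<subseteq> carrier (quot_mod W Z)"
      using tensor_W by (auto simp: present_def Z.quot_carrier)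
    show "carrier (quot_mod W Z) \<subseteq> range present"
    proof
      fix C assume "C \<in> carrier (quot_mod W Z)"
      then obtain t where t: "C = Z.proj (R.proj t)" "t \<in> carrier T"
        unfolding Z.quot_carrier W_carrier by blast
      then obtain p where "t - tensor p 1 \<in> R"
        using T_reduces_to_tensor by blast
      then have "R.proj t = R.proj (tensor p 1)"
        by (simp add: W_eq_iff t tensor_in_T)
      then show "C \<in> range present"
        by (simp add: t present_def)
    qed
  qed
next
  fix p q
  have "R.proj (tensor (p + q) 1) = R.proj (tensor p 1 + tensor q 1)"
    using relation_add[of p q 1]
    by (simp add: W_eq_iff tensor_in_T fvs.subspace_add[OF subspace_T] algebra_simps)
  then show "present (p + q) = present p \<oplus>\<^bsub>quot_mod W Z\<^esub> present q"
    by (simp add: present_def Z.quot_add tensor_W W_add tensor_in_T)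
next
  fix c p
  have "R.proj (tensor (fscale c p) 1) = R.proj (fscale c (tensor p 1))"
    using relation_scale[of c p 1]
    by (simp add: W_eq_iff tensor_in_T fvs.subspace_scale[OF subspace_T])
  then have eq: "R.proj (tensor (fscale c p) 1) = c \<odot>\<^bsub>W\<^esub> R.proj (tensor p 1)"
    by (simp add: W_smult tensor_in_T)
  have "(\<Union>u\<in>Z.proj (R.proj (tensor p 1)). Z.proj (c \<odot>\<^bsub>W\<^esub> u)) = Z.proj (c \<odot>\<^bsub>W\<^esub> R.proj (tensor p 1))"
  proof (rule Z.quot_lift[OF _ _ _ tensor_W])
    show "c \<odot>\<^bsub>W\<^esub> u \<in> carrier W" if "u \<in> carrier W" for u
      using that fvs.subspace_scale[OF subspace_T] by (auto simp: W_carrier W_smult)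
    show "c \<odot>\<^bsub>W\<^esub> (u \<oplus>\<^bsub>W\<^esub> v) = c \<odot>\<^bsub>W\<^esub> u \<oplus>\<^bsub>W\<^esub> c \<odot>\<^bsub>W\<^esub> v" if "u \<in> carrier W" "v \<in> carrier W" for u v
      using that fvs.subspace_scale[OF subspace_T] fvs.subspace_add[OF subspace_T]
      by (auto simp: W_carrier W_smult W_add fvs.scale_right_distrib)
    show "c \<odot>\<^bsub>W\<^esub> z \<in> Z" if "z \<in> Z" for z
      using that fvs.subspace_scale[OF subspace_T]
      by (auto simp: Z_eq W_smult M0_shift_closed simp flip: M0_shift_linear)
  qed
  then show "present (fscale c p) = c \<odot>\<^bsub>quot_mod W Z\<^esub> present p"
    by (simp add: present_def eq quot_mod_def)
next
  fix x p
  have eq: "R.proj (tensor (letter x * p) 1) = act W x (R.proj (tensor p 1))"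
    by (simp add: W_act tensor_in_T)
  have "(\<Union>u\<in>Z.proj (R.proj (tensor p 1)). Z.proj (act W x u)) = Z.proj (act W x (R.proj (tensor p 1)))"
  proof (rule Z.quot_lift[OF _ _ _ tensor_W])
    show "act W x u \<in> carrier W" if "u \<in> carrier W" for u
      using that left_mult_closed by (auto simp: W_carrier W_act)
    show "act W x (u \<oplus>\<^bsub>W\<^esub> v) = act W x u \<oplus>\<^bsub>W\<^esub> act W x v" if "u \<in> carrier W" "v \<in> carrier W" for u v
      using that left_mult_closed fvs.subspace_add[OF subspace_T]
      by (auto simp: W_carrier W_act W_add)
    show "act W x z \<in> Z" if "z \<in> Z" for z
      using that left_mult_closed by (auto simp: Z_eq W_act M0_shift_closed left_mult_M0_shift)
  qed
  then show "present (letter x * p) = act (quot_mod W Z) x (present p)"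
    by (simp add: present_def eq quot_mod_def)
qed

lemma in_annihilator_present_iff:
  "p \<in> annihilator (whittaker_quotient \<psi> \<xi>) present \<longleftrightarrow> (\<exists>t\<in>carrier T. tensor p 1 - M0_shift t \<in> R)"
proof -
  have "p \<in> annihilator (whittaker_quotient \<psi> \<xi>) present \<longleftrightarrow> R.proj (tensor p 1) \<in> Z"
    using Z.proj_eq_zero_iff[OF tensor_W] by (simp add: annihilator_def whittaker_quotient_eq present_def)
  also have "\<dots> \<longleftrightarrow> (\<exists>t\<in>carrier T. tensor p 1 - M0_shift t \<in> R)"
    unfolding Z_eq by (auto simp: W_eq_iff tensor_in_T M0_shift_closed image_iff)
  finally show ?thesis .
qed

lemma annihilator_ideal: "I_sv \<subseteq> annihilator (whittaker_quotient \<psi> \<xi>) present"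
proof
  fix p assume "p \<in> I_sv"
  then have "cls p = cls 0"
    by (simp add: cls_eq_iff)
  then have "present p = present 0"
    by (simp add: present_def)
  then show "p \<in> annihilator (whittaker_quotient \<psi> \<xi>) present"
    by (simp add: annihilator_def presents_zero[OF present_presents])
qed

lemma annihilator_whittaker:
  assumes "x \<in> carrier sv_plus"
  shows "letter x - fscale (\<psi> x) 1 \<in> annihilator (whittaker_quotient \<psi> \<xi>) present"
proof -
  interpret P: lie_module sv_plus "one_dim_module \<psi>"
    by (rule lie_module_one_dim[OF hom])
  have "free_act (one_dim_module \<psi>) (letter x) 1 = \<psi> x"
    using P.free_act_letter_one[OF assms] by (simp add: one_dim_module_def)
  then have "tensor (letter x) 1 - tensor 1 (\<psi> x) \<in> R"
    using relation_balanced[of "letter x" 1 1] assms by (simp add: free_alg_closed)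
  from fvs.span_diff[OF fvs.span_add[OF this relation_scale_right[of 1 "\<psi> x" 1]] relation_scale[of "\<psi> x" 1 1]]
  have "R.proj (tensor (letter x) 1) = R.proj (tensor (fscale (\<psi> x) 1) 1)"
    by (simp add: W_eq_iff tensor_in_T)
  then have "present (letter x) = present (fscale (\<psi> x) 1)"
    by (simp add: present_def)
  then show ?thesis
    by (simp add: presents_eq_iff[OF present_presents])
qed

lemma annihilator_M0:
  "gen (M 0) - fscale \<xi> 1 \<in> annihilator (whittaker_quotient \<psi> \<xi>) present"
  unfolding in_annihilator_present_iff
proof (rule bexI[OF _ tensor_in_T])
  have "(tensor (gen (M 0) + fscale (- \<xi>) 1) 1 - tensor (gen (M 0)) 1 - tensor (fscale (- \<xi>) 1) 1)
      + (tensor (fscale (- \<xi>) 1) 1 - fscale (- \<xi>) (tensor 1 1)) \<in> R"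
    by (intro fvs.span_add relation_add relation_scale)
  then show "tensor (gen (M 0) - fscale \<xi> 1) 1 - M0_shift (tensor 1 1) \<in> R"
    by (simp add: M0_shift_def algebra_simps)
qed

text \<open>The universal property of \<open>L\<^bsub>\<psi>,\<xi>\<^esub>\<close>: its annihilator is the least left ideal with the stated
properties. The map \<open>\<Phi>\<close> of the proof sends \<open>u \<otimes> v\<close> to \<open>v\<close> times a representative of \<open>u\<close> in the free
algebra; modulo \<open>J\<close> it respects all relations.\<close>

lemma annihilator_universal:
  assumes J: "left_ideal_sv J"
    and whittaker: "\<And>x. x \<in> carrier sv_plus \<Longrightarrow> letter x - fscale (\<psi> x) 1 \<in> J"
    and M0: "gen (M 0) - fscale \<xi> 1 \<in> J"
  shows "annihilator (whittaker_quotient \<psi> \<xi>) present \<subseteq> J"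
proof
  interpret J: left_ideal_sv J by fact
  interpret P: lie_module sv_plus "one_dim_module \<psi>"
    by (rule lie_module_one_dim[OF hom])
  have one_dim [simp]: "carrier (one_dim_module \<psi>) = UNIV" "ring.add (one_dim_module \<psi>) = (+)"
    "module.smult (one_dim_module \<psi>) = (*)" "\<zero>\<^bsub>one_dim_module \<psi>\<^esub> = 0"
    "act (one_dim_module \<psi>) = (\<lambda>x \<alpha>. \<psi> x * \<alpha>)"
    by (simp_all add: one_dim_module_def)
  have plus: "fscale v q - fscale (free_act (one_dim_module \<psi>) q v) 1 \<in> J" if "q \<in> free_plus" for q v
    using that
  proof (induction q rule: free_alg_carrier_induct)
    case (letter x q)
    let ?f = "free_act (one_dim_module \<psi>) q v"
    have "letter x * (fscale v q - fscale ?f 1) + fscale ?f (letter x - fscale (\<psi> x) 1) \<in> J"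
      by (intro J.J_add J.J_mult J.J_scale letter whittaker)
    then show ?case
      using letter(1,2)
      by (simp add: P.free_act_letter algebra_simps fvs.scale_right_diff_distrib)
  next
    case (add p q)
    then show ?case
      using J.J_add[OF add(3,4)]
      by (simp add: P.free_act_add fvs.scale_right_distrib fvs.scale_left_distrib algebra_simps)
  next
    case (scale c q)
    then show ?case
      using J.J_scale[OF scale(2), of c]
      by (simp add: P.free_act_scale fvs.scale_right_diff_distrib mult.commute)
  qed simp_all
  define \<Phi> :: "(free_sv set \<times> complex \<Rightarrow>\<^sub>0 complex) \<Rightarrow> free_sv" where
    "\<Phi> = lin_ext (\<lambda>(u, v). fscale v (SOME p. p \<in> u))"
  have \<Phi>_linear: "\<Phi> (s + t) = \<Phi> s + \<Phi> t" "\<Phi> (fscale c t) = fscale c (\<Phi> t)" "\<Phi> 0 = 0"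
    "\<Phi> (s - t) = \<Phi> s - \<Phi> t" for s t c
    using lin_ext_add[of "\<lambda>(u, v). fscale v (SOME p. p \<in> u)" "s - t" t]
    by (simp_all add: \<Phi>_def lin_ext_add lin_ext_scale)
  have tensor_diff: "\<Phi> (tensor p v) - fscale v p \<in> J" for p v
  proof -
    have "(SOME q. q \<in> cls p) \<in> cls p"
      by (rule someI[of _ p]) (simp add: in_cls)
    then have "fscale v ((SOME q. q \<in> cls p) - p) \<in> J"
      using J.ideal_sub by (auto simp: in_cls intro: J.J_scale)
    then show ?thesis
      by (simp add: \<Phi>_def pure_def fvs.scale_right_diff_distrib)
  qed
  have \<Phi>_R: "\<Phi> t \<in> J" if "t \<in> R" for t
    using that
  proof (induction t rule: R_induct)
    case (add_left p q v)
    show ?case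
      using J.J_diff[OF J.J_diff[OF tensor_diff[of "p + q" v] tensor_diff[of p v]] tensor_diff[of q v]]
      by (simp add: \<Phi>_linear algebra_simps fvs.scale_right_distrib)
  next
    case (add_right p v w)
    show ?case
      using J.J_diff[OF J.J_diff[OF tensor_diff[of p "v + w"] tensor_diff[of p v]] tensor_diff[of p w]]
      by (simp add: \<Phi>_linear algebra_simps fvs.scale_left_distrib)
  next
    case (scale_left c p v)
    show ?case
      using J.J_diff[OF tensor_diff[of "fscale c p" v] J.J_scale[OF tensor_diff[of p v], of c]]
      by (simp add: \<Phi>_linear algebra_simps fvs.scale_right_diff_distrib)
  next
    case (scale_right c p v)
    show ?case
      using J.J_diff[OF tensor_diff[of p "c * v"] J.J_scale[OF tensor_diff[of p v], of c]]
      by (simp add: \<Phi>_linear algebra_simps fvs.scale_right_diff_distrib)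
  next
    case (balanced p q v)
    let ?f = "free_act (one_dim_module \<psi>) q v"
    show ?case
      using J.J_add[OF J.J_diff[OF tensor_diff[of "p * q" v] tensor_diff[of p ?f]] J.J_mult[OF plus[OF balanced, of v], of p]]
      by (simp add: \<Phi>_linear algebra_simps)
  qed (simp_all add: \<Phi>_linear J.J_add J.J_scale)
  have \<Phi>_M0_shift: "\<Phi> (M0_shift t) \<in> J" if "t \<in> carrier T" for t
    using that
  proof (induction t rule: T_induct)
    case (tensor p v)
    have c: "gen (M 0) * p - p * gen (M 0) \<in> J"
      using J.J_uminus[OF subsetD[OF J.ideal_sub central_M0[of p]]] by simp
    have "\<Phi> (M0_shift (tensor p v)) = (\<Phi> (tensor (gen (M 0) * p) v) - fscale v (gen (M 0) * p))
        - fscale \<xi> (\<Phi> (tensor p v) - fscale v p)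
        + fscale v ((gen (M 0) * p - p * gen (M 0)) + p * (gen (M 0) - fscale \<xi> 1))"
      by (simp add: M0_shift_def \<Phi>_linear algebra_simps fvs.scale_right_diff_distrib fvs.scale_right_distrib mult.commute)
    also have "\<dots> \<in> J"
      by (rule J.J_add[OF J.J_diff[OF tensor_diff J.J_scale[OF tensor_diff]] J.J_scale[OF J.J_add[OF c J.J_mult[OF M0]]]])
    finally show ?case .
  qed (simp_all add: M0_shift_linear \<Phi>_linear J.J_add J.J_scale)
  fix p assume "p \<in> annihilator (whittaker_quotient \<psi> \<xi>) present"
  then obtain t where t: "t \<in> carrier T" "tensor p 1 - M0_shift t \<in> R"
    unfolding in_annihilator_present_iff by blast
  have "(\<Phi> (tensor p 1 - M0_shift t) + \<Phi> (M0_shift t)) - (\<Phi> (tensor p 1) - fscale 1 p) \<in> J"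
    by (intro J.J_diff J.J_add \<Phi>_R \<Phi>_M0_shift t tensor_diff)
  then show "p \<in> J"
    by (simp add: \<Phi>_linear)
qed

end

section \<open>Irreducible Whittaker modules\<close>

lemma positive_in_sv_plus: "positive k \<Longrightarrow> basis_vec k \<in> carrier sv_plus"
  by (cases k) (auto simp: sv_plus_def intro!: fvs.span_base)

text \<open>Every positive basis vector of weight at most \<open>-3\<close> other than \<open>M\<^sub>1\<close> is a nonzero multiple of a
bracket with \<open>L\<^sub>1\<close>, and \<open>\<psi>\<close> vanishes on brackets.\<close>

lemma character_values:
  assumes hom: "lie_hom sv_plus complex_lie \<psi>"
    and k: "positive k" "\<psi> (basis_vec k) \<noteq> 0" "k \<noteq> M 1"
  shows "wt k > -3"
proof (rule ccontr)
  assume wt: "\<not> wt k > -3"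
  \<comment> \<open>Lowering the index by one leaves a positive basis vector and a nonzero bracket with \<open>L\<^sub>1\<close>.\<close>
  obtain i where i: "positive i" "br_coeff (L 1) i \<noteq> 0" "br_index (L 1) i = k"
  proof (cases k)
    case (L n)
    then show ?thesis
      using wt that[of "L (n - 1)"] by simp
  next
    case (M n)
    then show ?thesis
      using k that[of "M (n - 1)"] by simp
  next
    case (Y n)
    then show ?thesis
      using wt that[of "Y (n - 1)"] by simp
  qed
  have "\<psi> (sv_bracket (basis_vec (L 1)) (basis_vec i)) = 0"
    using hom positive_in_sv_plus[OF i(1)] positive_in_sv_plus[of "L 1"]
    by (simp add: lie_hom_def complex_lie_def)
  then have "br_coeff (L 1) i * \<psi> (basis_vec k) = 0"
    using hom positive_in_sv_plus[OF k(1)] i(3)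
    by (simp add: sv_bracket_basis lie_hom_def complex_lie_def)
  then show False
    using i(2) k(2) by simp
qed

theorem theorem4p6:
  fixes \<psi> :: "sv \<Rightarrow> complex" and S :: "(sv, 'v) lie_mod"
  assumes "lie_hom sv_plus complex_lie \<psi>"
    and "\<psi> (basis_vec (M 1)) \<noteq> 0"
    and "irreducible_lie_module sv S"
    and "whittaker_module \<psi> S"
  shows "\<exists>\<xi>::complex. lie_modules_isomorphic sv S (whittaker_quotient \<psi> \<xi>)"
proof -
  obtain w where w: "whittaker_vector \<psi> S w" and generated: "lie_generated sv S {w} = carrier S"
    using assms(4) unfolding whittaker_module_def by blast
  have wS: "w \<in> carrier S" and act_w: "\<And>x. x \<in> carrier sv_plus \<Longrightarrow> act S x w = \<psi> x \<odot>\<^bsub>S\<^esub> w"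
    using w by (auto simp: whittaker_vector_def)
  interpret S: lie_module sv S
    using assms(3) by (simp add: irreducible_lie_module_def)
  have irred: "carrier S \<noteq> {\<zero>\<^bsub>S\<^esub>}"
    "\<And>N. lie_submodule sv S N \<Longrightarrow> N = {\<zero>\<^bsub>S\<^esub>} \<or> N = carrier S"
    using assms(3) by (auto simp: irreducible_lie_module_def)
  define \<theta> where "\<theta> p = free_act S p w" for p
  have \<theta>_closed: "\<theta> p \<in> carrier S" for p
    using S.free_act_closed[of p w] wS by (simp add: \<theta>_def)
  have \<theta>_add: "\<theta> (p + q) = \<theta> p \<oplus>\<^bsub>S\<^esub> \<theta> q" and \<theta>_scale: "\<theta> (fscale c p) = c \<odot>\<^bsub>S\<^esub> \<theta> p"
    and \<theta>_letter: "\<theta> (letter x * p) = act S x (\<theta> p)" for p q c x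
    using wS by (simp_all add: \<theta>_def S.free_act_add S.free_act_scale S.free_act_letter)
  have submodule: "lie_submodule sv S (\<theta> ` N)" if N: "left_ideal_sv N" for N
  proof -
    interpret N: left_ideal_sv N by fact
    have "submodule (\<theta> ` N) complex_ring S"
    proof (rule S.V.submoduleI)
      show "\<theta> ` N \<subseteq> carrier S"
        using \<theta>_closed by blast
      show "\<zero>\<^bsub>S\<^esub> \<in> \<theta> ` N"
        by (rule image_eqI[of _ _ 0]) (simp_all add: \<theta>_def)
      fix a assume "a \<in> \<theta> ` N"
      then obtain p where p: "a = \<theta> p" "p \<in> N" by blast
      have "\<ominus>\<^bsub>S\<^esub> a = \<theta> (fscale (-1) p)"
        by (simp only: \<theta>_scale p S.smult_minus_one[OF \<theta>_closed])
      then show "\<ominus>\<^bsub>S\<^esub> a \<in> \<theta> ` N"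
        using N.J_scale[OF p(2)] by blast
      show "c \<odot>\<^bsub>S\<^esub> a \<in> \<theta> ` N" for c
        using N.J_scale[OF p(2), of c] by (auto simp: p simp flip: \<theta>_scale)
      fix b assume "b \<in> \<theta> ` N"
      then obtain q where "b = \<theta> q" "q \<in> N" by blast
      then show "a \<oplus>\<^bsub>S\<^esub> b \<in> \<theta> ` N"
        using N.J_add[OF p(2)] by (auto simp: p simp flip: \<theta>_add)
    qed
    moreover have "act S x v \<in> \<theta> ` N" if "v \<in> \<theta> ` N" for x v
      using that N.J_mult by (auto simp flip: \<theta>_letter)
    ultimately show ?thesis
      by (simp add: lie_submodule_def)
  qed
  have "left_ideal_sv UNIV"
    by unfold_locales auto
  then have "lie_generated sv S {w} \<subseteq> range \<theta>"
    unfolding lie_generated_def using submodule[of UNIV] S.free_act_one[OF wS]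
    by (intro Inter_lower CollectI conjI) (auto simp: \<theta>_def intro: range_eqI[of _ _ 1])
  then have "range \<theta> = carrier S"
    using generated \<theta>_closed by auto
  then have pres: "presents S \<theta>"
    using S.V.abelian_group_axioms by (simp add: presents_def \<theta>_add \<theta>_scale \<theta>_letter)
  define J where "J = annihilator S \<theta>"
  have "I_sv \<subseteq> J"
    using S.uea_ideal_annihilates[OF _ wS] by (auto simp: J_def annihilator_def \<theta>_def)
  then have J_ideal: "left_ideal_sv J"
    unfolding J_def by (rule presents_left_ideal[OF pres])
  then interpret J: left_ideal_sv J .
  have J_whittaker: "letter x - fscale (\<psi> x) 1 \<in> J" if "x \<in> carrier sv_plus" for x
  proof -
    have "\<theta> (letter x) = \<theta> (fscale (\<psi> x) 1)"
      using act_w[OF that] S.free_act_letter_one[of x w] wS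
      unfolding \<theta>_scale by (simp add: \<theta>_def)
    then show ?thesis
      by (simp add: J_def presents_eq_iff[OF pres])
  qed
  note psi = character_values[OF assms(1)] assms(2)
  interpret J: whittaker_left_ideal J "\<lambda>k. \<psi> (basis_vec k)"
    by unfold_locales (use psi J_whittaker positive_in_sv_plus in auto)
  have one: "1 \<notin> J"
  proof
    assume "1 \<in> J"
    then have "\<theta> p = \<zero>\<^bsub>S\<^esub>" for p
      using J.J_mult[of 1 p] by (simp add: J_def annihilator_def)
    then have "carrier S = {\<zero>\<^bsub>S\<^esub>}"
      using presents_surj[OF pres] by auto
    then show False
      using irred by blast
  qed
  have maximal: "N = J \<or> N = UNIV" if N: "left_ideal_sv N" "J \<subseteq> N" for N
    using irred(2)[OF submodule[OF N(1)]]
  proof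
    assume "\<theta> ` N = {\<zero>\<^bsub>S\<^esub>}"
    then have "N \<subseteq> J"
      by (auto simp: J_def annihilator_def)
    then show ?thesis
      using N by blast
  next
    interpret N: left_ideal_sv N by fact
    assume surj: "\<theta> ` N = carrier S"
    have "p \<in> N" for p
    proof -
      obtain q where q: "q \<in> N" "\<theta> p = \<theta> q"
        using surj \<theta>_closed[of p] by (metis imageE)
      then have "p - q \<in> N"
        using N(2) by (auto simp: J_def presents_eq_iff[OF pres])
      then show ?thesis
        using N.J_add[OF _ q(1), of "p - q"] by simp
    qed
    then show ?thesis
      by blast
  qed
  obtain \<xi> where \<xi>: "gen (M 0) - fscale \<xi> 1 \<in> J"
    using J.central_character[OF one maximal] by blast
  interpret W: induced_whittaker \<psi> \<xi>
    by unfold_locales (rule assms(1))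
  let ?K = "annihilator (whittaker_quotient \<psi> \<xi>) W.present"
  have K_ideal: "left_ideal_sv ?K"
    by (rule presents_left_ideal[OF W.present_presents W.annihilator_ideal])
  then interpret K: left_ideal_sv ?K .
  interpret K: whittaker_left_ideal ?K "\<lambda>k. \<psi> (basis_vec k)"
    by unfold_locales (use psi W.annihilator_whittaker positive_in_sv_plus in auto)
  have KJ: "?K \<subseteq> J"
    by (rule W.annihilator_universal[OF J_ideal J_whittaker \<xi>])
  moreover have "J \<subseteq> ?K"
    by (rule K.simple_quotient[OF W.annihilator_M0 J_ideal KJ one])
  ultimately have "lie_modules_isomorphic sv S (whittaker_quotient \<psi> \<xi>)"
    by (intro isomorphic_if_annihilators_eq[OF pres W.present_presents]) (simp add: J_def)
  then show ?thesis ..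
qed

end
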